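(* Let $N\ge 1$ be an integer, let $k\ge 0$, $p>1$ and $\gamma\in[0,1)$, and let $u_0,\omega\in L^1(\mathbb{R}^N)$ be real-valued with $\int_{\mathbb{R}^N}\omega(x)\,dx>0$. Consider the problem $$\begin{cases} u_t-k\Delta u_t-\Delta u=I^\gamma_{0+}(|u|^{p})+\omega(x), & (t,x)\in(0,\infty)\times\mathbb{R}^N,\\ u(0,x)=u_0(x), & x\in\mathbb{R}^N,\end{cases}$$ where $I^\gamma_{0+}$ is the left Riemann-Liouville fractional integral of order $\gamma$ in the time variable (with $I^0_{0+}$ the identity). Then: (i) if $\gamma>0$, then for any $p>1$ the problem admits no global weak solution; (ii) if $\gamma=0$, $N\ge 3$ and $p=\frac{N}{N-2}$, then the problem admits no global weak solution.
   Context: **Fractional integrals.** For $\gamma\in(0,1)$, $T>0$ and an integrable function $v$ on $(0,T)$, the left and right Riemann-Liouville fractional integrals are $$I^\gamma_{0+}v(t)=\frac{1}{\Gamma(\gamma)}\int_0^t (t-s)^{\gamma-1}v(s)\,ds,\qquad I^\gamma_{T-}v(t)=\frac{1}{\Gamma(\gamma)}\int_t^T (s-t)^{\gamma-1}v(s)\,ds .$$ For $\gamma=0$ one sets $I^0_{0+}v=v$ and $I^0_{T-}v=v$. Applied to functions of $(t,x)$, these operators act in the variable $t$. $\Delta$ denotes the Laplacian in $x\in\mathbb{R}^N$. **Global weak solution.** A real-valued function $u\in L^p_{\mathrm{loc}}([0,\infty)\times\mathbb{R}^N)$ (i.e. $|u|^p$ is integrable on every compact subset of $[0,\infty)\times\mathbb{R}^N$)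 is called a global weak solution of the problem if the identity $$\int_0^T\!\!\int_{\mathbb{R}^{N}}|u|^{p}\,(I^\gamma_{T-}\varphi)\,dx\,dt+\int_0^T\!\!\int_{\mathbb{R}^{N}}\omega\varphi\,dx\,dt+\int_{\mathbb{R}^{N}}u_0(x)\big(\varphi(0,x)-k\Delta\varphi(0,x)\big)\,dx$$ $$=-\int_0^T\!\!\int_{\mathbb{R}^{N}}u\,\varphi_t\,dx\,dt+k\int_0^T\!\!\int_{\mathbb{R}^{N}}u\,\Delta\varphi_t\,dx\,dt-\int_0^T\!\!\int_{\mathbb{R}^{N}}u\,\Delta\varphi\,dx\,dt$$ holds for all $T>0$ and all test functions $\varphi\in C^{1,2}_{t,x}([0,T],\mathbb{R}^N)$ with $\varphi\ge 0$, $\varphi(T,\cdot)=0$, and $\mathrm{supp}_x\varphi\subset\subset\mathbb{R}^N$ (there is a compact set $K\subset\mathbb{R}^N$ with $\varphi(t,x)=0$ for all $t\in[0,T]$ and $x\notin K$). Here $\varphi\in C^{1,2}_{t,x}$ means that $\varphi$ and $\varphi_t$, together with all their partial derivatives in $x$ of order at most $2$, exist and are continuous on $[0,T]\times\mathbb{R}^N$. *)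

theory Defs
  imports "HOL-Analysis.Analysis"
begin

text \<open>
  Right Riemann--Liouville fractional integral on \<open>(0,T)\<close>. At \<open>s = t\<close> the kernel is \<open>0 powr (\<gamma> - 1) = 0\<close>,
  which only affects a null set.
\<close>

definition RL_right :: "real \<Rightarrow> real \<Rightarrow> (real \<Rightarrow> real) \<Rightarrow> real \<Rightarrow> real" where
  "RL_right \<gamma> T v t =
     (if \<gamma> = 0 then v t
      else 1 / Gamma \<gamma> * (LINT s:{t..T}|lebesgue. (s - t) powr (\<gamma> - 1) * v s))"

definition has_partial_x :: "'n::finite \<Rightarrow> (real^'n \<Rightarrow> real) \<Rightarrow> real^'n \<Rightarrow> bool" where
  "has_partial_x i f x \<longleftrightarrow> (\<lambda>h. f (x + h *\<^sub>R axis i 1)) differentiable (at 0)"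

definition partial_x :: "'n::finite \<Rightarrow> (real^'n \<Rightarrow> real) \<Rightarrow> real^'n \<Rightarrow> real" where
  "partial_x i f x = deriv (\<lambda>h. f (x + h *\<^sub>R axis i 1)) 0"

definition laplacian :: "(real^'n::finite \<Rightarrow> real) \<Rightarrow> real^'n \<Rightarrow> real" where
  "laplacian f x = (\<Sum>i\<in>UNIV. partial_x i (partial_x i f) x)"

text \<open>Functions on \<open>[0,T] \<times> \<real>\<^sup>N\<close> are total functions whose values at times outside \<open>{0..T}\<close>
  are ignored; accordingly the time derivative is one-sided at \<open>t = 0\<close> and \<open>t = T\<close>.\<close>

definition time_deriv ::
    "real \<Rightarrow> (real \<Rightarrow> real^'n::finite \<Rightarrow> real) \<Rightarrow> real \<Rightarrow> real^'n \<Rightarrow> real" where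
  "time_deriv T \<phi> t x = vector_derivative (\<lambda>s. \<phi> s x) (at t within {0..T})"

definition C02_tx :: "real \<Rightarrow> (real \<Rightarrow> real^'n::finite \<Rightarrow> real) \<Rightarrow> bool" where
  "C02_tx T \<psi> \<longleftrightarrow>
     continuous_on ({0..T} \<times> UNIV) (\<lambda>(t, x). \<psi> t x) \<and>
     (\<forall>i. (\<forall>t\<in>{0..T}. \<forall>x. has_partial_x i (\<psi> t) x) \<and>
          continuous_on ({0..T} \<times> UNIV) (\<lambda>(t, x). partial_x i (\<psi> t) x)) \<and>
     (\<forall>i j. (\<forall>t\<in>{0..T}. \<forall>x. has_partial_x j (partial_x i (\<psi> t)) x) \<and>
          continuous_on ({0..T} \<times> UNIV) (\<lambda>(t, x). partial_x j (partial_x i (\<psi> t)) x))"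

definition C12_tx :: "real \<Rightarrow> (real \<Rightarrow> real^'n::finite \<Rightarrow> real) \<Rightarrow> bool" where
  "C12_tx T \<phi> \<longleftrightarrow>
     C02_tx T \<phi> \<and>
     (\<forall>t\<in>{0..T}. \<forall>x. (\<lambda>s. \<phi> s x) differentiable (at t within {0..T})) \<and>
     C02_tx T (time_deriv T \<phi>)"

definition test_function :: "real \<Rightarrow> (real \<Rightarrow> real^'n::finite \<Rightarrow> real) \<Rightarrow> bool" where
  "test_function T \<phi> \<longleftrightarrow>
     C12_tx T \<phi> \<and>
     (\<forall>t\<in>{0..T}. \<forall>x. \<phi> t x \<ge> 0) \<and>
     (\<forall>x. \<phi> T x = 0) \<and>
     (\<exists>K. compact K \<and> (\<forall>t\<in>{0..T}. \<forall>x. x \<notin> K \<longrightarrow> \<phi> t x = 0))"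

definition Lp_loc :: "real \<Rightarrow> (real \<Rightarrow> real^'n::finite \<Rightarrow> real) \<Rightarrow> bool" where
  "Lp_loc p u \<longleftrightarrow>
     (\<lambda>(t, x). u t x) \<in> borel_measurable (lebesgue_on ({0..} \<times> UNIV)) \<and>
     (\<forall>K. compact K \<and> K \<subseteq> {0..} \<times> UNIV \<longrightarrow>
        set_integrable lebesgue K (\<lambda>(t, x). \<bar>u t x\<bar> powr p))"

text \<open>
  Weak formulation of \<open>u\<^sub>t - k \<Delta>u\<^sub>t - \<Delta>u = I\<^sup>\<gamma>\<^sub>0\<^sub>+ (|u|\<^sup>p) + \<omega>\<close>, \<open>u(0, \<cdot>) = u\<^sub>0\<close>; the left fractional integral
  has been moved onto the test function, where it becomes its adjoint \<^const>\<open>RL_right\<close>.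
  Space-time integrals are taken with respect to Lebesgue measure on \<open>[0,T] \<times> \<real>\<^sup>N\<close>. For
  \<open>u\<close> in \<^const>\<open>Lp_loc\<close> with \<open>p > 1\<close>, integrable \<open>u0\<close> and \<open>\<omega>\<close>, and a test function \<open>\<phi>\<close>, all
  integrands are absolutely integrable, so by Fubini these are the iterated integrals.
\<close>

definition global_weak_solution ::
    "real \<Rightarrow> real \<Rightarrow> real \<Rightarrow> (real^'n::finite \<Rightarrow> real) \<Rightarrow> (real^'n \<Rightarrow> real) \<Rightarrow>
     (real \<Rightarrow> real^'n \<Rightarrow> real) \<Rightarrow> bool" where
  "global_weak_solution k p \<gamma> u0 \<omega> u \<longleftrightarrow>
     Lp_loc p u \<and>
     (\<forall>T>0. \<forall>\<phi>. test_function T \<phi> \<longrightarrow>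
        (LINT (t, x):{0..T} \<times> UNIV|lebesgue. \<bar>u t x\<bar> powr p * RL_right \<gamma> T (\<lambda>s. \<phi> s x) t)
        + (LINT (t, x):{0..T} \<times> UNIV|lebesgue. \<omega> x * \<phi> t x)
        + (LINT x|lebesgue. u0 x * (\<phi> 0 x - k * laplacian (\<phi> 0) x))
        = - (LINT (t, x):{0..T} \<times> UNIV|lebesgue. u t x * time_deriv T \<phi> t x)
          + k * (LINT (t, x):{0..T} \<times> UNIV|lebesgue. u t x * laplacian (time_deriv T \<phi> t) x)
          - (LINT (t, x):{0..T} \<times> UNIV|lebesgue. u t x * laplacian (\<phi> t) x))"

end

theory Submission
  imports Defs
begin

text \<open>
  The proof is by the test function method. Suppose that \<open>u\<close> is a global weak solution, and test the weak
  formulation with \<open>\<phi>(t, x) = (1 - t/T)^m \<xi>(x)\<close>, where \<open>\<xi>\<close> is a cutoff function that equals \<open>1\<close> on the ball of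
  radius \<open>R\<close>, vanishes outside the ball of radius \<open>2R\<close> and satisfies \<open>\<bar>\<Delta>\<xi>\<bar> \<le> C R^(-2) \<xi>^(1/p)\<close>. The fractional
  integral maps \<open>(1 - t/T)^m\<close> to a multiple of \<open>T^\<gamma> (1 - t/T)^(m+\<gamma>)\<close>, so the nonlinear term is
  \<open>c T^\<gamma> E(\<xi>)\<close>, where \<open>E(f)\<close> is the integral of \<open>\<bar>u\<bar>^p (1 - t/T)^(m+\<gamma>) f(x)\<close> over \<open>[0,T] \<times> \<real>^N\<close>. The source
  contributes \<open>T/(m+1)\<close> times the integral of \<open>\<omega>\<xi>\<close>, and the initial datum contributes a number that does not depend
  on \<open>T\<close>. Each term with \<open>u\<close> on the other side is estimated by Young's inequality
  \<open>a b \<le> \<kappa> a^p + \<kappa>^(-1/(p-1)) b^q\<close>, \<open>q = p/(p-1)\<close>, at the cost of a multiple of \<open>E(\<xi>)\<close>; for the terms that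
  contain \<open>\<Delta>\<xi>\<close> the energy \<open>E\<close> is needed only on the shell \<open>R < \<bar>x\<bar> \<le> 2R\<close>. This gives
  \<open>cutoff_energy_inequality\<close>, in which everything is explicit in \<open>T\<close> and \<open>R\<close>.

  If \<open>\<gamma> > 0\<close>, the factor \<open>T^\<gamma>\<close> in front of \<open>E(\<xi>)\<close> allows \<open>\<kappa>\<close> to be of size \<open>T^\<gamma>\<close>, so that all error terms,
  divided by \<open>T\<close>, tend to \<open>0\<close> as \<open>T\<close> grows with \<open>R\<close> fixed. As the integral of \<open>\<omega>\<xi>\<close> is positive for large
  \<open>R\<close>, this is a contradiction (\<open>no_global_weak_solution_fractional\<close>).

  If \<open>\<gamma> = 0\<close> and \<open>p = N/(N-2)\<close>, then \<open>2q = N\<close> and the error from \<open>\<Delta>\<xi>\<close>, divided by \<open>T\<close>, is bounded but does not decay: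
  the volume \<open>R^N\<close> cancels \<open>R^(-2q)\<close>. The inequality is then used twice. With a small
  \<open>\<kappa>\<close> it bounds \<open>E(\<xi>)/T\<close> uniformly in \<open>R\<close> for \<open>T\<close> large. With the energy of \<open>\<xi>\<close> absorbed completely and a large
  Young constant on the shell, it bounds the energy of every single shell from below by \<open>\<delta> T\<close>. The dyadic shells
  \<open>2^j R0 < \<bar>x\<bar> \<le> 2^(j+1) R0\<close> are disjoint, so the first \<open>M\<close> of them carry energy at least \<open>M \<delta> T\<close>, which contradicts
  the uniform bound for large \<open>M\<close> (\<open>no_global_weak_solution_critical\<close>).
\<close>

section \<open>Powers of the positive part\<close>

definition pos_pow :: "nat \<Rightarrow> real \<Rightarrow> real" where
  "pos_pow n y = (max 0 y) ^ n"

lemma pos_pow_nonneg [simp]: "0 \<le> pos_pow n y"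
  by (simp add: pos_pow_def)

lemma pos_pow_nonpos: "y \<le> 0 \<Longrightarrow> n > 0 \<Longrightarrow> pos_pow n y = 0"
  by (simp add: pos_pow_def max_def)

lemma pos_pow_le_1: "y \<le> 1 \<Longrightarrow> pos_pow n y \<le> 1"
  by (simp add: pos_pow_def power_le_one)

lemma continuous_on_pos_pow [continuous_intros]:
  "continuous_on S f \<Longrightarrow> continuous_on S (\<lambda>x. pos_pow n (f x))"
  unfolding pos_pow_def by (intro continuous_intros)

text \<open>
  The one-sided derivatives agree at the origin because the exponent is at least \<open>2\<close>. Applied repeatedly, this
  rule makes functions built from third powers of the positive part twice continuously differentiable.
\<close>
lemma pos_pow_has_derivative:
  assumes "n \<ge> 2"
  shows "(pos_pow n has_real_derivative real n * pos_pow (n - 1) y) (at y)"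
proof -
  consider "y > 0" | "y < 0" | "y = 0" by linarith
  then show ?thesis
  proof cases
    case 1
    have "((\<lambda>y. y ^ n) has_real_derivative real n * pos_pow (n - 1) y) (at y)"
      using 1 by (auto intro!: derivative_eq_intros simp: pos_pow_def)
    then show ?thesis
      by (rule has_field_derivative_transform_within_open[where S = "{0<..}"])
        (use 1 in \<open>auto simp: pos_pow_def\<close>)
  next
    case 2
    have "((\<lambda>y. 0) has_real_derivative real n * pos_pow (n - 1) y) (at y)"
      using 2 assms by (simp add: pos_pow_nonpos)
    then show ?thesis
      by (rule has_field_derivative_transform_within_open[where S = "{..<0}"])
        (use 2 assms in \<open>auto simp: pos_pow_nonpos\<close>)
  next
    case 3
    have "((\<lambda>h. pos_pow n h / h) \<longlongrightarrow> 0) (at 0)"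
    proof (rule Lim_null_comparison)
      show "\<forall>\<^sub>F h in at 0. norm (pos_pow n h / h) \<le> \<bar>h\<bar> ^ (n - 1)"
      proof (rule always_eventually, rule allI)
        fix h :: real
        have "pos_pow n h = pos_pow (n - 1) h * max 0 h"
          using assms by (simp add: pos_pow_def flip: power_Suc2)
        moreover have "pos_pow (n - 1) h \<le> \<bar>h\<bar> ^ (n - 1)"
          unfolding pos_pow_def by (rule power_mono) auto
        ultimately show "norm (pos_pow n h / h) \<le> \<bar>h\<bar> ^ (n - 1)"
          by (cases "h > 0") (auto simp: max_def)
      qed
      show "((\<lambda>h::real. \<bar>h\<bar> ^ (n - 1)) \<longlongrightarrow> 0) (at 0)"
        using assms by (auto intro!: tendsto_eq_intros)
    qed
    then show ?thesis
      using 3 assms by (simp add: has_field_derivative_iff pos_pow_nonpos)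
  qed
qed

section \<open>Partial derivatives and the radial cutoff\<close>

text \<open>
  Existence and value of a partial derivative in one predicate, so that the differentiation rules compose.
\<close>
definition has_px :: "'n::finite \<Rightarrow> (real^'n \<Rightarrow> real) \<Rightarrow> real \<Rightarrow> real^'n \<Rightarrow> bool" where
  "has_px i f D x \<longleftrightarrow> ((\<lambda>h. f (x + h *\<^sub>R axis i 1)) has_real_derivative D) (at 0)"

lemma has_px_imp:
  assumes "has_px i f D x"
  shows has_px_imp_has_partial_x: "has_partial_x i f x" and has_px_imp_partial_x: "partial_x i f x = D"
  using assms unfolding has_px_def has_partial_x_def partial_x_def
  by (auto simp: real_differentiable_def intro: DERIV_imp_deriv)

lemma has_partial_x_imp_has_px: "has_partial_x i f x \<Longrightarrow> has_px i f (partial_x i f x) x"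
  unfolding has_px_def has_partial_x_def partial_x_def
  by (simp add: DERIV_deriv_iff_real_differentiable)

lemma has_px_const: "has_px i (\<lambda>x. c) 0 x"
  unfolding has_px_def by simp

lemma has_px_coord: "has_px i (\<lambda>x. x $ j) (if i = j then 1 else 0) x"
  unfolding has_px_def by (auto intro!: derivative_eq_intros simp: axis_def)

lemma has_px_mult:
  "has_px i f D x \<Longrightarrow> has_px i g E x \<Longrightarrow> has_px i (\<lambda>x. f x * g x) (D * g x + f x * E) x"
  unfolding has_px_def by (auto intro!: derivative_eq_intros)

lemma has_px_diff:
  "has_px i f D x \<Longrightarrow> has_px i g E x \<Longrightarrow> has_px i (\<lambda>x. f x - g x) (D - E) x"
  unfolding has_px_def by (auto intro!: derivative_eq_intros)

lemma has_px_chain: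
  assumes "has_px i g E x" and "(F has_real_derivative D) (at (g x))"
  shows "has_px i (\<lambda>x. F (g x)) (D * E) x"
  using assms unfolding has_px_def
  by (intro DERIV_chain2[where f = F]) auto

lemma has_px_norm_sq: "has_px i (\<lambda>x. (norm x)\<^sup>2) (2 * x $ i) x"
proof -
  have eq: "(norm (x + h *\<^sub>R axis i 1))\<^sup>2 = (norm x)\<^sup>2 + 2 * h * x $ i + h\<^sup>2" for h
    unfolding power2_norm_eq_inner
    by (simp add: inner_add_left inner_add_right inner_axis inner_axis' power2_eq_square algebra_simps)
  show ?thesis
    unfolding has_px_def eq by (auto intro!: derivative_eq_intros)
qed

text \<open>
  With \<open>s = \<bar>x\<bar>\<^sup>2/R\<^sup>2\<close>, the inner expression \<open>1 - pos_pow 3 (s - 1)\<close> decreases from \<open>1\<close> at \<open>s = 1\<close> to \<open>0\<close> at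
  \<open>s = 2\<close>. Using \<open>\<bar>x\<bar>\<^sup>2\<close> avoids the singularity of the norm at the origin, and the outer power \<open>m\<close> makes the derivatives
  of the cutoff small compared with a power of the cutoff itself.
\<close>
definition cutoff :: "nat \<Rightarrow> real \<Rightarrow> real^'n::finite \<Rightarrow> real" where
  "cutoff m R x = pos_pow m (1 - pos_pow 3 ((norm x)\<^sup>2 / R\<^sup>2 - 1))"

context
  fixes R :: real
  assumes R: "R > 0"
begin

text \<open>
  The intermediate functions of the chain rule: \<open>prof\<close> is the base of the outer power, \<open>prof1\<close> and \<open>prof2\<close>
  are its first and second partial derivatives, and \<open>cutoff1\<close> and \<open>cutoff2\<close> are those of the cutoff.
\<close>
private definition rad :: "real^'n::finite \<Rightarrow> real" where "rad x = (norm x)\<^sup>2 / R\<^sup>2 - 1"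

private lemma rad_px: "has_px i rad (2 * x $ i / R\<^sup>2) x"
  using has_px_diff[OF has_px_mult[OF has_px_norm_sq[of i x] has_px_const[of i "1 / R\<^sup>2" x]] has_px_const[of i 1 x]]
  by (simp add: rad_def[abs_def])

private definition prof :: "real^'n::finite \<Rightarrow> real" where "prof x = 1 - pos_pow 3 (rad x)"

private definition prof1 :: "'n \<Rightarrow> real^'n::finite \<Rightarrow> real" where
  "prof1 i x = - (6 / R\<^sup>2 * (pos_pow 2 (rad x) * x $ i))"

private definition prof2 :: "'n \<Rightarrow> 'n \<Rightarrow> real^'n::finite \<Rightarrow> real" where
  "prof2 i j x = - (6 / R\<^sup>2 * (4 / R\<^sup>2 * pos_pow 1 (rad x) * x $ j * x $ i + pos_pow 2 (rad x) * (if j = i then 1 else 0)))"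

private lemma prof_px: "has_px i prof (prof1 i x) x"
proof -
  have "has_px i (\<lambda>x. pos_pow 3 (rad x)) (3 * pos_pow 2 (rad x) * (2 * x $ i / R\<^sup>2)) x"
    using has_px_chain[OF rad_px[of i x] pos_pow_has_derivative[of 3 "rad x"]] by simp
  from has_px_diff[OF has_px_const[of i 1 x] this] show ?thesis
    by (simp add: prof_def[abs_def] prof1_def mult_ac)
qed

private lemma prof1_px: "has_px j (prof1 i) (prof2 i j x) x"
proof -
  have "has_px j (\<lambda>x. pos_pow 2 (rad x)) (2 * pos_pow 1 (rad x) * (2 * x $ j / R\<^sup>2)) x"
    using has_px_chain[OF rad_px[of j x] pos_pow_has_derivative[of 2 "rad x"]] by simp
  from has_px_mult[OF has_px_const[of j "- 6 / R\<^sup>2" x] has_px_mult[OF this has_px_coord[of j i x]]]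
  show ?thesis
    by (simp add: prof1_def[abs_def] prof2_def mult_ac)
qed

private definition cutoff1 :: "nat \<Rightarrow> 'n \<Rightarrow> real^'n::finite \<Rightarrow> real" where
  "cutoff1 m i x = real m * (pos_pow (m - 1) (prof x) * prof1 i x)"

private definition cutoff2 :: "nat \<Rightarrow> 'n \<Rightarrow> 'n \<Rightarrow> real^'n::finite \<Rightarrow> real" where
  "cutoff2 m i j x = real m * (real (m - 1) * pos_pow (m - 2) (prof x) * prof1 j x * prof1 i x
     + pos_pow (m - 1) (prof x) * prof2 i j x)"

private lemma cutoff_px:
  assumes "m \<ge> 3"
  shows "has_px i (cutoff m R) (cutoff1 m i x) x"
  using has_px_chain[OF prof_px[of i x] pos_pow_has_derivative[of m "prof x"]] assms
  by (simp add: cutoff1_def cutoff_def[abs_def] prof_def rad_def mult_ac)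

private lemma cutoff_px2:
  assumes "m \<ge> 3"
  shows "has_px j (cutoff1 m i) (cutoff2 m i j x) x"
proof -
  have "m - 1 - 1 = m - 2" by simp
  then have "has_px j (\<lambda>x. pos_pow (m - 1) (prof x)) (real (m - 1) * pos_pow (m - 2) (prof x) * prof1 j x) x"
    using has_px_chain[OF prof_px[of j x] pos_pow_has_derivative[of "m - 1" "prof x"]] assms by simp
  from has_px_mult[OF has_px_const[of j "real m" x] has_px_mult[OF this prof1_px[of j i x]]]
  show ?thesis
    by (simp add: cutoff1_def[abs_def] cutoff2_def mult_ac)
qed

private lemma cutoff_partial_x:
  assumes "m \<ge> 3"
  shows "partial_x i (cutoff m R) = cutoff1 m i"
    and "partial_x j (cutoff1 m i) = cutoff2 m i j"
  using cutoff_px[OF assms] cutoff_px2[OF assms] by (auto intro!: ext has_px_imp_partial_x)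

lemma cutoff_C2:
  assumes "m \<ge> 3"
  shows "continuous_on UNIV (cutoff m R :: real^'n::finite \<Rightarrow> real)"
    and "has_partial_x i (cutoff m R) (x :: real^'n::finite)"
    and "continuous_on UNIV (partial_x i (cutoff m R) :: real^'n::finite \<Rightarrow> real)"
    and "has_partial_x j (partial_x i (cutoff m R)) (x :: real^'n::finite)"
    and "continuous_on UNIV (partial_x j (partial_x i (cutoff m R)) :: real^'n::finite \<Rightarrow> real)"
proof -
  have rad: "continuous_on UNIV (rad :: real^'n \<Rightarrow> real)"
    unfolding rad_def[abs_def] using R by (intro continuous_intros) auto
  have prof: "continuous_on UNIV (prof :: real^'n \<Rightarrow> real)"
    unfolding prof_def[abs_def] by (intro continuous_intros rad)
  have prof1: "continuous_on UNIV (prof1 i :: real^'n \<Rightarrow> real)" for i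
    unfolding prof1_def[abs_def] by (intro continuous_intros rad)
  have prof2: "continuous_on UNIV (prof2 i j :: real^'n \<Rightarrow> real)" for i j
    unfolding prof2_def[abs_def] by (intro continuous_intros rad)
  have "continuous_on UNIV (\<lambda>x :: real^'n. pos_pow m (prof x))"
    by (intro continuous_intros prof)
  then show "continuous_on UNIV (cutoff m R :: real^'n \<Rightarrow> real)"
    by (simp add: cutoff_def[abs_def] prof_def rad_def)
  show "continuous_on UNIV (partial_x i (cutoff m R) :: real^'n \<Rightarrow> real)"
    unfolding cutoff_partial_x[OF assms] cutoff1_def[abs_def]
    by (intro continuous_intros prof prof1)
  show "continuous_on UNIV (partial_x j (partial_x i (cutoff m R)) :: real^'n \<Rightarrow> real)"
    unfolding cutoff_partial_x[OF assms] cutoff2_def[abs_def]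
    by (intro continuous_intros prof prof1 prof2)
  show "has_partial_x i (cutoff m R) x" by (rule has_px_imp_has_partial_x[OF cutoff_px[OF assms]])
  show "has_partial_x j (partial_x i (cutoff m R)) x"
    unfolding cutoff_partial_x[OF assms] by (rule has_px_imp_has_partial_x[OF cutoff_px2[OF assms]])
qed

lemma cutoff_nonneg: "0 \<le> cutoff m R x"
  by (simp add: cutoff_def)

lemma cutoff_le_1: "cutoff m R x \<le> 1"
  unfolding cutoff_def by (rule pos_pow_le_1) simp

lemma cutoff_eq_1:
  assumes "norm x \<le> R"
  shows "cutoff m R x = 1"
proof -
  have "(norm x)\<^sup>2 \<le> R\<^sup>2" using assms by (intro power_mono) auto
  then have "(norm x)\<^sup>2 / R\<^sup>2 - 1 \<le> 0" using R by (simp add: field_simps)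
  then show ?thesis by (simp add: cutoff_def pos_pow_nonpos) (simp add: pos_pow_def)
qed

private lemma prof_nonpos:
  assumes "norm x \<ge> 2 * R"
  shows "prof x \<le> 0"
proof -
  have "(2 * R)\<^sup>2 \<le> (norm x)\<^sup>2" using assms R by (intro power_mono) auto
  then have "4 * R\<^sup>2 \<le> (norm x)\<^sup>2" by (simp add: power_mult_distrib)
  moreover have "0 \<le> R\<^sup>2" by simp
  ultimately have "2 * R\<^sup>2 \<le> (norm x)\<^sup>2" by linarith
  then have "1 \<le> rad x" unfolding rad_def using R by (simp add: field_simps)
  then have "1 \<le> pos_pow 3 (rad x)" by (simp add: pos_pow_def)
  then show ?thesis by (simp add: prof_def)
qed

lemma cutoff_eq_0:
  assumes "norm x \<ge> 2 * R" "m > 0"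
  shows "cutoff m R x = 0"
  using pos_pow_nonpos[OF prof_nonpos[OF assms(1)] assms(2)]
  by (simp add: cutoff_def prof_def rad_def)

text \<open>
  Two derivatives lower the outer power from \<open>m\<close> to at least \<open>m - 2\<close>, and the base is at most \<open>1\<close>, so the condition
  \<open>m/p \<le> m - 2\<close> turns what is left into the \<open>p\<close>-th root of the cutoff. Every term of \<open>prof1\<close> and
  \<open>prof2\<close> has a positive part of \<open>rad\<close> as a factor, so both vanish in the ball of radius \<open>R\<close>. Where the base is positive,
  \<open>\<bar>x\<bar> \<le> 2R\<close> and \<open>rad \<le> 1\<close>; this gives \<open>144/R\<^sup>2\<close> for the square of \<open>prof1\<close> and \<open>102/R\<^sup>2\<close> for \<open>prof2\<close>, and
  \<open>246\<close> is the sum of these two constants. Differentiating the outer power costs at most \<open>m\<^sup>2\<close>, and the Laplacian has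
  as many summands as there are coordinates.
\<close>
lemma cutoff_laplacian_bound:
  fixes x :: "real^'n::finite"
  assumes "m \<ge> 3" "p > 0" and mp: "real m / p \<le> real m - 2"
  shows "\<bar>laplacian (cutoff m R) x\<bar> \<le> 246 * real CARD('n) * (real m)\<^sup>2 / R\<^sup>2
      * cutoff m R x powr (1 / p) * indicator {x. R < norm x \<and> norm x \<le> 2 * R} x"
proof -
  have lap: "laplacian (cutoff m R) x = (\<Sum>i\<in>UNIV. cutoff2 m i i x)"
    unfolding laplacian_def cutoff_partial_x[OF assms(1)] ..
  consider "norm x \<le> R" | "norm x > 2 * R" | "R < norm x" "norm x \<le> 2 * R" by linarith
  then show ?thesis
  proof cases
    case 1
    have "(norm x)\<^sup>2 \<le> R\<^sup>2" using 1 by (intro power_mono) auto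
    then have rad: "rad x \<le> 0" using R by (simp add: rad_def field_simps)
    have "cutoff2 m i i x = 0" for i
      by (simp add: cutoff2_def prof1_def prof2_def pos_pow_nonpos[OF rad])
    then show ?thesis using 1 by (simp add: lap)
  next
    case 2
    then have prof: "prof x \<le> 0" by (intro prof_nonpos) auto
    have "cutoff2 m i i x = 0" for i
      using assms(1) by (simp add: cutoff2_def pos_pow_nonpos[OF prof])
    then show ?thesis using 2 by (simp add: lap)
  next
    case 3
    have prof1: "prof x \<le> 1" by (simp add: prof_def)
    have fin: "pos_pow (m - 2) (prof x) \<le> cutoff m R x powr (1 / p)"
    proof (cases "prof x > 0")
      case True
      have "pos_pow (m - 2) (prof x) = prof x powr (real m - 2)"
        using True assms(1) by (simp add: pos_pow_def powr_realpow[symmetric] of_nat_diff)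
      also have "\<dots> \<le> prof x powr (real m / p)"
        using True prof1 mp by (intro powr_mono') auto
      also have "\<dots> = cutoff m R x powr (1 / p)"
      proof -
        have "cutoff m R x = prof x powr real m"
          using True by (simp add: cutoff_def pos_pow_def[of m] powr_realpow prof_def rad_def)
        then show ?thesis by (simp add: powr_powr)
      qed
      finally show ?thesis .
    next
      case False
      then show ?thesis using assms(1) by (simp add: pos_pow_nonpos)
    qed
    have cutoff2: "\<bar>cutoff2 m i i x\<bar> \<le> (real m)\<^sup>2 * pos_pow (m - 2) (prof x) * (246 / R\<^sup>2)" for i
    proof (cases "prof x > 0")
      case False
      then show ?thesis using assms(1) by (simp add: cutoff2_def pos_pow_nonpos)
    next
      case True
      have q1: "rad x \<le> 1"
      proof (rule ccontr)
        assume "\<not> rad x \<le> 1"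
        then have "1 \<le> pos_pow 3 (rad x)" by (simp add: pos_pow_def)
        with True show False by (simp add: prof_def)
      qed
      have x: "\<bar>x $ i\<bar> \<le> 2 * R" using 3 component_le_norm_cart[of x i] by linarith
      then have x2: "(x $ i)\<^sup>2 \<le> (2 * R)\<^sup>2" using R by (subst abs_le_square_iff[symmetric]) auto
      have P: "0 \<le> pos_pow n (rad x)" "pos_pow n (rad x) \<le> 1" for n
        using pos_pow_le_1[OF q1] by auto
      have "(prof1 i x)\<^sup>2 = 36 / R^4 * ((pos_pow 2 (rad x))\<^sup>2 * (x $ i)\<^sup>2)"
        by (simp add: prof1_def power_mult_distrib power_divide)
      also have "\<dots> \<le> 36 / R^4 * (1 * (2 * R)\<^sup>2)"
        using P x2 by (intro mult_left_mono mult_mono power_le_one) auto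
      also have "\<dots> = 144 / R\<^sup>2"
        using R by (simp add: field_simps power2_eq_square power4_eq_xxxx)
      finally have a1: "(prof1 i x)\<^sup>2 \<le> 144 / R\<^sup>2" .
      have "\<bar>prof2 i i x\<bar> = 24 / R^4 * (pos_pow 1 (rad x) * (x $ i)\<^sup>2) + 6 / R\<^sup>2 * pos_pow 2 (rad x)"
      proof -
        have "prof2 i i x = - (24 / R^4 * (pos_pow 1 (rad x) * (x $ i)\<^sup>2) + 6 / R\<^sup>2 * pos_pow 2 (rad x))"
          using R by (simp add: prof2_def field_simps power2_eq_square power4_eq_xxxx)
        moreover have "0 \<le> 24 / R^4 * (pos_pow 1 (rad x) * (x $ i)\<^sup>2) + 6 / R\<^sup>2 * pos_pow 2 (rad x)"
          by (intro add_nonneg_nonneg mult_nonneg_nonneg) auto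
        ultimately show ?thesis by linarith
      qed
      also have "\<dots> \<le> 24 / R^4 * (1 * (2 * R)\<^sup>2) + 6 / R\<^sup>2 * 1"
        using P x2 by (intro add_mono mult_left_mono mult_mono) auto
      also have "\<dots> = 102 / R\<^sup>2"
        using R by (simp add: field_simps power2_eq_square power4_eq_xxxx)
      finally have a2: "\<bar>prof2 i i x\<bar> \<le> 102 / R\<^sup>2" .
      have "m - 1 = Suc (m - 2)" using assms(1) by simp
      then have "pos_pow (m - 1) (prof x) = prof x * pos_pow (m - 2) (prof x)"
        using True by (simp add: pos_pow_def)
      then have le: "pos_pow (m - 1) (prof x) \<le> pos_pow (m - 2) (prof x)"
        using True prof1 by (simp add: mult_left_le_one_le)
      have "\<bar>cutoff2 m i i x\<bar> \<le> real m * (real (m - 1) * (pos_pow (m - 2) (prof x) * (prof1 i x)\<^sup>2)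
          + pos_pow (m - 1) (prof x) * \<bar>prof2 i i x\<bar>)"
      proof -
        define A where "A = real (m - 1) * (pos_pow (m - 2) (prof x) * (prof1 i x)\<^sup>2)"
        have "A \<ge> 0" by (simp add: A_def)
        have "cutoff2 m i i x = real m * (A + pos_pow (m - 1) (prof x) * prof2 i i x)"
          by (simp add: A_def cutoff2_def power2_eq_square mult_ac)
        moreover have "\<bar>A + pos_pow (m - 1) (prof x) * prof2 i i x\<bar> \<le> A + pos_pow (m - 1) (prof x) * \<bar>prof2 i i x\<bar>"
          using abs_triangle_ineq[of A "pos_pow (m - 1) (prof x) * prof2 i i x"] \<open>A \<ge> 0\<close>
          by (simp add: abs_mult)
        ultimately show ?thesis unfolding A_def[symmetric] by (simp add: abs_mult mult_left_mono)
      qed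
      also have "\<dots> \<le> real m * (real m * (pos_pow (m - 2) (prof x) * (144 / R\<^sup>2))
          + real m * (pos_pow (m - 2) (prof x) * (102 / R\<^sup>2)))"
      proof -
        have "pos_pow (m - 1) (prof x) * \<bar>prof2 i i x\<bar> \<le> pos_pow (m - 2) (prof x) * (102 / R\<^sup>2)"
          using le a2 by (intro mult_mono) auto
        also have "\<dots> \<le> real m * (pos_pow (m - 2) (prof x) * (102 / R\<^sup>2))"
          using assms(1) mult_right_mono[of 1 "real m" "pos_pow (m - 2) (prof x) * (102 / R\<^sup>2)"] by simp
        finally have "pos_pow (m - 1) (prof x) * \<bar>prof2 i i x\<bar>
            \<le> real m * (pos_pow (m - 2) (prof x) * (102 / R\<^sup>2))" .
        moreover have "real (m - 1) * (pos_pow (m - 2) (prof x) * (prof1 i x)\<^sup>2)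
            \<le> real m * (pos_pow (m - 2) (prof x) * (144 / R\<^sup>2))"
          using a1 by (intro mult_mono mult_left_mono) auto
        ultimately show ?thesis
          by (intro mult_left_mono add_mono) auto
      qed
      also have "\<dots> = (real m)\<^sup>2 * pos_pow (m - 2) (prof x) * (246 / R\<^sup>2)"
        by (simp add: field_simps power2_eq_square)
      finally show ?thesis .
    qed
    have "\<bar>laplacian (cutoff m R) x\<bar> \<le> (\<Sum>i\<in>(UNIV :: 'n set). \<bar>cutoff2 m i i x\<bar>)"
      unfolding lap by (rule sum_abs)
    also have "\<dots> \<le> (\<Sum>i\<in>(UNIV :: 'n set). (real m)\<^sup>2 * pos_pow (m - 2) (prof x) * (246 / R\<^sup>2))"
      by (intro sum_mono cutoff2)
    also have "\<dots> = 246 * real CARD('n) * (real m)\<^sup>2 / R\<^sup>2 * pos_pow (m - 2) (prof x)"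
      by simp
    also have "\<dots> \<le> 246 * real CARD('n) * (real m)\<^sup>2 / R\<^sup>2 * cutoff m R x powr (1 / p)"
      using fin by (intro mult_left_mono) auto
    finally show ?thesis using 3 by simp
  qed
qed

end

section \<open>The test functions and their fractional integrals\<close>

lemma C02_tx_product:
  fixes f :: "real^'n::finite \<Rightarrow> real"
  assumes \<psi>: "\<And>t. t \<in> {0..T} \<Longrightarrow> \<psi> t = (\<lambda>x. a t * f x)"
    and a: "continuous_on {0..T} a"
    and f: "continuous_on UNIV f"
    and f1: "\<And>i x. has_partial_x i f x" "\<And>i. continuous_on UNIV (partial_x i f)"
    and f2: "\<And>i j x. has_partial_x j (partial_x i f) x"
      "\<And>i j. continuous_on UNIV (partial_x j (partial_x i f))"
  shows "C02_tx T \<psi>"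
    and "\<And>t x. t \<in> {0..T} \<Longrightarrow> laplacian (\<psi> t) x = a t * laplacian f x"
proof -
  have cont: "continuous_on ({0..T} \<times> UNIV) (\<lambda>(t, x). F t x)"
    if "continuous_on UNIV h" "\<And>t x. t \<in> {0..T} \<Longrightarrow> F t x = a t * h x" for h :: "real^'n \<Rightarrow> real" and F
  proof -
    have "continuous_on ({0..T} \<times> (UNIV :: (real^'n) set)) (\<lambda>z. a (fst z) * h (snd z))"
      by (intro continuous_intros continuous_on_compose2[OF a] continuous_on_compose2[OF that(1)]) auto
    then show ?thesis
      by (rule continuous_on_eq) (auto simp: that(2))
  qed
  have px: "has_px i (\<lambda>x. c * h x) (c * partial_x i h x) x" if "has_partial_x i h x"
    for i c x and h :: "real^'n \<Rightarrow> real"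
    using has_px_mult[OF has_px_const[of i c x] has_partial_x_imp_has_px[OF that]] by simp
  have p1: "partial_x i (\<psi> t) = (\<lambda>x. a t * partial_x i f x)" if "t \<in> {0..T}" for t i
    unfolding \<psi>[OF that] by (intro ext has_px_imp_partial_x px f1)
  have p2: "partial_x j (partial_x i (\<psi> t)) = (\<lambda>x. a t * partial_x j (partial_x i f) x)"
    if "t \<in> {0..T}" for t i j
    unfolding p1[OF that] by (intro ext has_px_imp_partial_x px f2)
  show "C02_tx T \<psi>"
    unfolding C02_tx_def
  proof (intro conjI allI ballI)
    show "continuous_on ({0..T} \<times> UNIV) (\<lambda>(t, x). \<psi> t x)"
      by (rule cont[OF f]) (simp add: \<psi>)
    show "has_partial_x i (\<psi> t) x" if "t \<in> {0..T}" for t x i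
      unfolding \<psi>[OF that] by (rule has_px_imp_has_partial_x[OF px[OF f1(1)]])
    show "continuous_on ({0..T} \<times> UNIV) (\<lambda>(t, x). partial_x i (\<psi> t) x)" for i
      by (rule cont[OF f1(2)[of i]]) (simp add: p1)
    show "has_partial_x j (partial_x i (\<psi> t)) x" if "t \<in> {0..T}" for t x i j
      unfolding p1[OF that] by (rule has_px_imp_has_partial_x[OF px[OF f2(1)]])
    show "continuous_on ({0..T} \<times> UNIV) (\<lambda>(t, x). partial_x j (partial_x i (\<psi> t)) x)" for i j
      by (rule cont[OF f2(2)[of j i]]) (simp add: p2)
  qed
  show "laplacian (\<psi> t) x = a t * laplacian f x" if "t \<in> {0..T}" for t x
    unfolding laplacian_def p2[OF that] by (simp add: sum_distrib_left)
qed

lemma time_deriv_power: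
  assumes "T > 0" "t \<in> {0..T}"
  shows "time_deriv T (\<lambda>t x. (1 - t / T) ^ m * f x) t x = - (real m / T) * (1 - t / T) ^ (m - 1) * f x"
    and "(\<lambda>s. (1 - s / T) ^ m * f x) differentiable (at t within {0..T})"
proof -
  have "((\<lambda>s. (1 - s / T) ^ m * f x) has_vector_derivative
      (- (real m / T) * (1 - t / T) ^ (m - 1) * f x)) (at t within {0..T})"
    unfolding has_real_derivative_iff_has_vector_derivative[symmetric]
    using assms(1) by (auto intro!: derivative_eq_intros)
  then show "time_deriv T (\<lambda>t x. (1 - t / T) ^ m * f x) t x = - (real m / T) * (1 - t / T) ^ (m - 1) * f x"
    and "(\<lambda>s. (1 - s / T) ^ m * f x) differentiable (at t within {0..T})"
    unfolding time_deriv_def using assms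
    by (auto intro: vector_derivative_within_closed_interval differentiableI_vector)
qed

lemma test_function_cutoff:
  fixes T R :: real
  assumes "T > 0" "R > 0" "m \<ge> 3"
  defines "\<phi> \<equiv> \<lambda>t (x :: real^'n::finite). (1 - t / T) ^ m * cutoff m R x"
  shows "test_function T \<phi>"
    and "t \<in> {0..T} \<Longrightarrow> laplacian (\<phi> t) x = (1 - t / T) ^ m * laplacian (cutoff m R) x"
    and "t \<in> {0..T} \<Longrightarrow> laplacian (time_deriv T \<phi> t) x
          = - (real m / T) * (1 - t / T) ^ (m - 1) * laplacian (cutoff m R) x"
proof -
  note C2 = cutoff_C2[OF assms(2,3), where ?'n = 'n]
  have c: "continuous_on {0..T} (\<lambda>t. (1 - t / T) ^ m)"
    "continuous_on {0..T} (\<lambda>t. - (real m / T) * (1 - t / T) ^ (m - 1))"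
    using assms(1) by (auto intro!: continuous_intros)
  have td: "time_deriv T \<phi> t = (\<lambda>x. - (real m / T) * (1 - t / T) ^ (m - 1) * cutoff m R x)"
    if "t \<in> {0..T}" for t
    unfolding \<phi>_def by (rule ext, rule time_deriv_power[OF assms(1) that])
  note P1 = C02_tx_product[of T \<phi> _ "cutoff m R", OF _ c(1) C2]
  note P2 = C02_tx_product[of T "time_deriv T \<phi>" _ "cutoff m R", OF _ c(2) C2]
  show "t \<in> {0..T} \<Longrightarrow> laplacian (\<phi> t) x = (1 - t / T) ^ m * laplacian (cutoff m R) x"
    by (rule P1(2)) (auto simp: \<phi>_def)
  show "t \<in> {0..T} \<Longrightarrow> laplacian (time_deriv T \<phi> t) x
          = - (real m / T) * (1 - t / T) ^ (m - 1) * laplacian (cutoff m R) x"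
    by (rule P2(2)) (auto simp: td)
  have "C12_tx T \<phi>"
    unfolding C12_tx_def
  proof (intro conjI ballI allI)
    show "C02_tx T \<phi>" by (rule P1(1)) (auto simp: \<phi>_def)
    show "C02_tx T (time_deriv T \<phi>)" by (rule P2(1)) (auto simp: td)
    show "(\<lambda>s. \<phi> s x) differentiable (at t within {0..T})" if "t \<in> {0..T}" for t x
      unfolding \<phi>_def by (rule time_deriv_power(2)[OF assms(1) that])
  qed
  moreover have "\<exists>K. compact K \<and> (\<forall>t\<in>{0..T}. \<forall>x. x \<notin> K \<longrightarrow> \<phi> t x = 0)"
    using assms cutoff_eq_0[of R _ m, where ?'a = 'n]
    by (intro exI[of _ "cball 0 (2 * R)"]) (auto simp: \<phi>_def)
  moreover have "\<phi> t x \<ge> 0" if "t \<in> {0..T}" for t x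
    using that assms unfolding \<phi>_def by (intro mult_nonneg_nonneg zero_le_power cutoff_nonneg) auto
  moreover have "\<phi> T x = 0" for x
    using assms by (simp add: \<phi>_def)
  ultimately show "test_function T \<phi>"
    unfolding test_function_def by blast
qed

lemma RL_right_mult: "RL_right \<gamma> T (\<lambda>s. v s * c) t = RL_right \<gamma> T v t * c"
  unfolding RL_right_def set_lebesgue_integral_def by (simp add: mult.assoc[symmetric] del: mult.assoc)

definition RL_power_const :: "real \<Rightarrow> nat \<Rightarrow> real" where
  "RL_power_const \<gamma> m = Gamma (real m + 1) / Gamma (real m + 1 + \<gamma>)"

lemma RL_power_const_pos: "\<gamma> \<ge> 0 \<Longrightarrow> RL_power_const \<gamma> m > 0"
  unfolding RL_power_const_def by (intro divide_pos_pos Gamma_real_pos) auto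

text \<open>
  For \<open>\<gamma> = 0\<close> the operator is the identity and the constant is \<open>1\<close>. Otherwise the substitution
  \<open>s = t + (T - t) \<sigma>\<close> turns the integral into a Beta integral times \<open>(T - t)^\<gamma> ((T - t)/T)^m = T^\<gamma> (1 - t/T)^(m+\<gamma>)\<close>.
  At \<open>t = T\<close> both sides are \<open>0\<close>.
\<close>
lemma RL_right_power:
  assumes "T > 0" "t \<in> {0..T}" "\<gamma> \<ge> 0" "m > 0"
  shows "RL_right \<gamma> T (\<lambda>s. (1 - s / T) ^ m) t
       = RL_power_const \<gamma> m * T powr \<gamma> * (1 - t / T) powr (real m + \<gamma>)"
proof (cases "\<gamma> = 0")
  case True
  have "Gamma (real m + 1) \<noteq> 0" using Gamma_real_pos[of "real m + 1"] by linarith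
  then have "RL_power_const 0 m = 1" by (simp add: RL_power_const_def)
  then show ?thesis
    using assms True by (simp add: RL_right_def powr_realpow')
next
  case False
  show ?thesis
  proof (cases "t = T")
    case True
    have "(LINT s:{T..T}|lebesgue. (s - T) powr (\<gamma> - 1) * (1 - s / T) ^ m) = 0"
    proof -
      have "(\<lambda>s. indicator {T..T} s *\<^sub>R ((s - T) powr (\<gamma> - 1) * (1 - s / T) ^ m)) = (\<lambda>_. 0)"
        by (auto simp: indicator_def)
      then show ?thesis unfolding set_lebesgue_integral_def by simp
    qed
    then show ?thesis using True False assms by (simp add: RL_right_def)
  next
    case neq: False
    define L where "L = T - t"
    have L: "L > 0" using neq assms by (simp add: L_def)
    have "((\<lambda>\<sigma>. \<sigma> powr (\<gamma> - 1) * (1 - \<sigma>) powr (real m + 1 - 1)) has_integral Beta \<gamma> (real m + 1)) {0..1}"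
      using False assms by (intro has_integral_Beta_real) auto
    then have B: "((\<lambda>\<sigma>. \<sigma> powr (\<gamma> - 1) * (1 - \<sigma>) ^ m) has_integral Beta \<gamma> (real m + 1)) (cbox 0 1)"
      unfolding cbox_interval
      by (rule has_integral_eq[rotated]) (use assms in \<open>auto simp: powr_realpow'\<close>)
    have img: "(\<lambda>\<sigma>. t + \<sigma> * (T - t)) ` {0..1} = {t..T}"
      using image_affinity_atLeastAtMost[of "T - t" t 0 1] assms neq
      by (simp add: mult.commute add.commute)
    from has_integral_affinity[OF B, of "1 / L" "- t / L"] L
    have "((\<lambda>s. ((s - t) / L) powr (\<gamma> - 1) * (1 - (s - t) / L) ^ m) has_integral L * Beta \<gamma> (real m + 1)) {t..T}"
      by (simp add: diff_divide_distrib L_def[symmetric] algebra_simps) (simp add: L_def img)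
    then have "((\<lambda>s. L powr (\<gamma> - 1) * (L / T) ^ m * (((s - t) / L) powr (\<gamma> - 1) * (1 - (s - t) / L) ^ m)) has_integral
        L powr (\<gamma> - 1) * (L / T) ^ m * (L * Beta \<gamma> (real m + 1))) {t..T}"
      by (rule has_integral_mult_right)
    then have I: "((\<lambda>s. (s - t) powr (\<gamma> - 1) * (1 - s / T) ^ m) has_integral
        L powr (\<gamma> - 1) * (L / T) ^ m * (L * Beta \<gamma> (real m + 1))) {t..T}"
    proof (rule has_integral_eq[rotated])
      fix s assume s: "s \<in> {t..T}"
      have "L powr (\<gamma> - 1) * ((s - t) / L) powr (\<gamma> - 1) = (s - t) powr (\<gamma> - 1)"
        using L s by (simp add: powr_mult[symmetric])
      moreover have "(L / T) ^ m * (1 - (s - t) / L) ^ m = (1 - s / T) ^ m"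
      proof -
        have "L / T * (1 - (s - t) / L) = 1 - s / T"
          using L assms(1) by (simp add: field_simps L_def)
        then show ?thesis by (simp add: power_mult_distrib[symmetric])
      qed
      ultimately show "L powr (\<gamma> - 1) * (L / T) ^ m * (((s - t) / L) powr (\<gamma> - 1) * (1 - (s - t) / L) ^ m)
          = (s - t) powr (\<gamma> - 1) * (1 - s / T) ^ m"
        by (metis (no_types, lifting) mult.assoc mult.left_commute)
    qed
    have "set_integrable lebesgue {t..T} (\<lambda>s. (s - t) powr (\<gamma> - 1) * (1 - s / T) ^ m)"
      using I assms by (intro nonnegative_absolutely_integrable_1)
        (auto simp: integrable_on_def intro!: mult_nonneg_nonneg zero_le_power)
    from set_lebesgue_integral_eq_integral(2)[OF this] I
    have "(LINT s:{t..T}|lebesgue. (s - t) powr (\<gamma> - 1) * (1 - s / T) ^ m)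
       = L powr (\<gamma> - 1) * (L / T) ^ m * (L * Beta \<gamma> (real m + 1))"
      by (simp add: integral_unique)
    also have "\<dots> = (L powr \<gamma> * (L / T) ^ m) * Beta \<gamma> (real m + 1)"
      using L by (simp add: powr_diff)
    also have "L powr \<gamma> * (L / T) ^ m = T powr \<gamma> * (1 - t / T) powr (real m + \<gamma>)"
    proof -
      have "L = T * (1 - t / T)" "0 < 1 - t / T" using assms L by (auto simp: L_def field_simps)
      moreover from this have "L powr \<gamma> = T powr \<gamma> * (1 - t / T) powr \<gamma>"
        using assms by (simp add: powr_mult)
      moreover have "L / T = 1 - t / T" using assms by (simp add: L_def field_simps)
      ultimately show ?thesis
        by (simp add: powr_add powr_realpow)
    qed
    finally have eq: "(LINT s:{t..T}|lebesgue. (s - t) powr (\<gamma> - 1) * (1 - s / T) ^ m)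
       = T powr \<gamma> * (1 - t / T) powr (real m + \<gamma>) * Beta \<gamma> (real m + 1)" .
    have "Gamma \<gamma> > 0" using False assms by (intro Gamma_real_pos) auto
    then show ?thesis
      using False unfolding RL_right_def eq Beta_def RL_power_const_def
      by (simp add: add_ac)
  qed
qed

section \<open>Integrals over space and time\<close>

text \<open>
  Lebesgue measure on the product is the completion of the product measure, so Fubini's theorem does not apply to
  a Lebesgue measurable \<open>h\<close> directly. Replacing \<open>h\<close> by a Borel function changes the integrand only on \<open>\<real> \<times> M\<close>, which
  is a null set because \<open>M\<close> is one.
\<close>
lemma integral_product_time_space:
  fixes h :: "real^'n::finite \<Rightarrow> real" and a :: "real \<Rightarrow> real"
  assumes a: "continuous_on {0..T} a" and h: "integrable lebesgue h"
  shows "set_integrable lebesgue ({0..T} \<times> UNIV) (\<lambda>(t, x). a t * h x)"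
    and "(LINT (t, x):{0..T} \<times> UNIV|lebesgue. a t * h x)
       = (LINT t:{0..T}|lebesgue. a t) * (LINT x|lebesgue. h x)"
proof -
  obtain h' where h'[measurable]: "h' \<in> borel_measurable lborel" and hh: "AE x in lborel. h x = h' x"
    using completion_ex_borel_measurable_real[OF borel_measurable_integrable[OF h]] by auto
  have ih': "integrable lborel h'" and Lh: "(LINT x|lebesgue. h x) = (LINT x|lborel. h' x)"
  proof -
    have "AE x in lebesgue. h x = h' x" using hh by (rule AE_completion)
    then have "integrable lebesgue h'" "(LINT x|lebesgue. h x) = (LINT x|lebesgue. h' x)"
      using h measurable_completion[OF h'] by (auto intro: integrable_cong_AE_imp integral_cong_AE)
    then show "integrable lborel h'" "(LINT x|lebesgue. h x) = (LINT x|lborel. h' x)"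
      using h' by (auto simp: integrable_completion integral_completion)
  qed
  define b where "b t = indicator {0..T} t * a t" for t
  have ib: "integrable lborel b"
    using borel_integrable_atLeastAtMost'[OF a] by (simp add: set_integrable_def b_def[abs_def])
  have b[measurable]: "b \<in> borel_measurable borel"
    using borel_measurable_integrable[OF ib] by simp
  have h''[measurable]: "h' \<in> borel_measurable borel" using h' by simp
  have meas: "(\<lambda>z. b (fst z) * h' (snd z)) \<in> borel_measurable (lborel \<Otimes>\<^sub>M lborel)"
    by measurable
  have "integrable (lborel \<Otimes>\<^sub>M lborel) (\<lambda>z. b (fst z) * h' (snd z))"
  proof (rule lborel_pair.Fubini_integrable[OF meas])
    have "(\<lambda>t. LINT x|lborel. norm (b (fst (t, x)) * h' (snd (t, x)))) = (\<lambda>t. \<bar>b t\<bar> * (LINT x|lborel. \<bar>h' x\<bar>))"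
      by (simp add: abs_mult)
    then show "integrable lborel (\<lambda>t. LINT x|lborel. norm (b (fst (t, x)) * h' (snd (t, x))))"
      using ib by simp
    show "AE t in lborel. integrable lborel (\<lambda>x. b (fst (t, x)) * h' (snd (t, x)))"
      using ih' by simp
  qed
  from this lborel_pair.integral_fst'[OF this]
  have P: "integrable lborel (\<lambda>z. b (fst z) * h' (snd z))"
    "(LINT z|lborel. b (fst z) * h' (snd z)) = (LINT t|lborel. b t) * (LINT x|lborel. h' x)"
    by (simp_all add: lborel_prod)
  then have Q: "integrable lebesgue (\<lambda>z. b (fst z) * h' (snd z))"
    "(LINT z|lebesgue. b (fst z) * h' (snd z)) = (LINT t|lborel. b t) * (LINT x|lborel. h' x)"
    using borel_measurable_integrable[OF P(1)] by (simp_all add: integrable_completion integral_completion)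
  have ae: "AE z in lebesgue. b (fst z) * h' (snd z) = b (fst z) * h (snd z)"
  proof -
    obtain N where N: "N \<in> null_sets lborel" "\<And>x. h x \<noteq> h' x \<Longrightarrow> x \<in> N"
    proof -
      obtain N where "{x \<in> space lborel. h x \<noteq> h' x} \<subseteq> N" "emeasure lborel N = 0" "N \<in> sets lborel"
        using AE_E[OF hh] by blast
      then show ?thesis by (intro that[of N]) (auto simp: null_sets_def)
    qed
    have "(UNIV :: real set) \<times> N \<in> null_sets (lborel \<Otimes>\<^sub>M lborel)"
      using N by (intro lborel.times_in_null_sets2) auto
    then have "AE z in lborel. z \<notin> (UNIV :: real set) \<times> N"
      unfolding lborel_prod by (rule AE_not_in)
    then have "AE z in lebesgue. z \<notin> (UNIV :: real set) \<times> N"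
      by (rule AE_completion)
    then show ?thesis
      by eventually_elim (use N in \<open>auto simp: mem_Times_iff\<close>)
  qed
  have m: "(\<lambda>z. b (fst z) * h (snd z)) \<in> borel_measurable lebesgue"
    by (rule borel_measurable_AE[OF borel_measurable_integrable[OF Q(1)] ae])
  have eq: "(\<lambda>z. indicator ({0..T} \<times> UNIV) z *\<^sub>R (case z of (t, x) \<Rightarrow> a t * h x)) = (\<lambda>z. b (fst z) * h (snd z))"
    by (auto simp: b_def indicator_def split: prod.splits)
  show "set_integrable lebesgue ({0..T} \<times> UNIV) (\<lambda>(t, x). a t * h x)"
    unfolding set_integrable_def eq by (rule integrable_cong_AE_imp[OF Q(1) m ae])
  have "(LINT z|lebesgue. b (fst z) * h (snd z)) = (LINT z|lebesgue. b (fst z) * h' (snd z))"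
    using ae by (intro integral_cong_AE m borel_measurable_integrable[OF Q(1)]) (auto elim: eventually_mono)
  moreover have "(LINT t:{0..T}|lebesgue. a t) = (LINT t|lborel. b t)"
    unfolding set_lebesgue_integral_def b_def[symmetric] real_scaleR_def
    using b by (intro integral_completion) simp
  ultimately show "(LINT (t, x):{0..T} \<times> UNIV|lebesgue. a t * h x)
       = (LINT t:{0..T}|lebesgue. a t) * (LINT x|lebesgue. h x)"
    unfolding set_lebesgue_integral_def[of _ "{0..T} \<times> UNIV"] eq by (simp add: Q(2) Lh)
qed

lemma integral_time_power:
  assumes "T > 0"
  shows "(LINT t:{0..T}|lebesgue. (1 - t / T) ^ m) = T / (real m + 1)"
proof -
  have c: "continuous_on {0..T} (\<lambda>t. (1 - t / T) ^ m)"
    using assms by (intro continuous_intros) auto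
  have "((\<lambda>t. (1 - t / T) ^ m) has_integral
      (- T / (real m + 1) * (1 - T / T) ^ Suc m) - (- T / (real m + 1) * (1 - 0 / T) ^ Suc m)) {0..T}"
  proof (rule fundamental_theorem_of_calculus)
    fix t assume "t \<in> {0..T}"
    have "- T / (real m + 1) * ((real m + 1) * (1 - t / T) ^ m * (- (1 / T))) = (1 - t / T) ^ m"
      using assms by simp
    moreover have "((\<lambda>t. - T / (real m + 1) * (1 - t / T) ^ Suc m) has_real_derivative
        - T / (real m + 1) * ((real m + 1) * (1 - t / T) ^ m * (- (1 / T)))) (at t within {0..T})"
      using assms by (auto intro!: derivative_eq_intros simp: add.commute simp del: power_Suc)
    ultimately show "((\<lambda>t. - T / (real m + 1) * (1 - t / T) ^ Suc m) has_vector_derivative (1 - t / T) ^ m)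
        (at t within {0..T})"
      by (simp only: has_real_derivative_iff_has_vector_derivative[symmetric])
  qed (use assms in auto)
  then have "integral {0..T} (\<lambda>t. (1 - t / T) ^ m) = T / (real m + 1)"
    using assms by (intro integral_unique) simp
  moreover have "set_integrable lebesgue {0..T} (\<lambda>t. (1 - t / T) ^ m)"
    using absolutely_integrable_continuous_real[OF c] .
  ultimately show ?thesis
    by (simp add: set_lebesgue_integral_eq_integral(2))
qed

section \<open>Weighted energies\<close>

text \<open>
  Young's inequality for \<open>\<kappa>^(1/p) a\<close> and \<open>\<kappa>^(-1/p) b\<close>, without the factors \<open>1/p\<close> and \<open>1/q\<close>.
\<close>
lemma weighted_young:
  fixes \<kappa> p a b :: real
  assumes "\<kappa> > 0" "p > 1" "a \<ge> 0" "b \<ge> 0"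
  shows "a * b \<le> \<kappa> * a powr p + \<kappa> powr (- 1 / (p - 1)) * b powr (p / (p - 1))"
proof -
  define q where "q = p / (p - 1)"
  have q: "q > 1" "1 / p + 1 / q = 1" "q * (1 / p) = 1 / (p - 1)"
    using assms(2) by (auto simp: q_def field_simps)
  have "a * b = (\<kappa> powr (1 / p) * a) * (\<kappa> powr (- 1 / p) * b)"
    using assms(1) by (simp add: powr_minus_divide)
  also have "\<dots> \<le> (\<kappa> powr (1 / p) * a) powr p / p + (\<kappa> powr (- 1 / p) * b) powr q / q"
    using assms q by (intro Youngs_inequality) auto
  also have "\<dots> \<le> (\<kappa> powr (1 / p) * a) powr p + (\<kappa> powr (- 1 / p) * b) powr q"
    using assms q by (intro add_mono) (auto simp: divide_le_eq mult_le_cancel_left1)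
  also have "(\<kappa> powr (1 / p) * a) powr p = \<kappa> * a powr p"
    using assms by (simp add: powr_mult powr_powr)
  also have "(\<kappa> powr (- 1 / p) * b) powr q = \<kappa> powr (- 1 / (p - 1)) * b powr q"
    using assms q(3) by (simp add: powr_mult powr_powr mult.commute)
  finally show ?thesis by (simp add: q_def)
qed

text \<open>
  The exponent \<open>\<alpha>\<close> will be \<open>m + \<gamma>\<close>, the power of \<open>1 - t/T\<close> that the fractional integral produces.
\<close>
definition energy ::
    "real \<Rightarrow> real \<Rightarrow> real \<Rightarrow> (real \<Rightarrow> real^'n::finite \<Rightarrow> real) \<Rightarrow> (real^'n \<Rightarrow> real) \<Rightarrow> real" where
  "energy p \<alpha> T u f =
     (LINT (t, x):{0..T} \<times> UNIV|lebesgue. \<bar>u t x\<bar> powr p * ((1 - t / T) powr \<alpha> * f x))"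

text \<open>
  The class of spatial weights: local integrability of \<open>\<bar>u\<bar>^p\<close> makes the energy finite for them.
\<close>
definition bump :: "real \<Rightarrow> (real^'n::finite \<Rightarrow> real) \<Rightarrow> bool" where
  "bump r f \<longleftrightarrow> f \<in> borel_measurable borel \<and> (\<forall>x. 0 \<le> f x \<and> f x \<le> 1) \<and> (\<forall>x. norm x > r \<longrightarrow> f x = 0)"

lemma energy_integrable:
  assumes u: "Lp_loc p u" and f: "bump r f" and "T > 0" "\<alpha> \<ge> 0"
  shows "set_integrable lebesgue ({0..T} \<times> UNIV) (\<lambda>(t, x). \<bar>u t x\<bar> powr p * ((1 - t / T) powr \<alpha> * f x))"
proof -
  define K where "K = {0..T} \<times> cball (0 :: real^'a) r"
  have fm[measurable]: "f \<in> borel_measurable borel" using f by (simp add: bump_def)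
  have "compact K" "K \<subseteq> {0..} \<times> UNIV"
    by (auto simp: K_def compact_Times)
  then have iK: "integrable lebesgue (\<lambda>z. indicator K z *\<^sub>R (case z of (t, x) \<Rightarrow> \<bar>u t x\<bar> powr p))"
    using u by (simp add: Lp_loc_def set_integrable_def)
  have wm: "(\<lambda>z. (1 - fst z / T) powr \<alpha> * f (snd z)) \<in> borel_measurable lebesgue"
  proof (rule measurable_completion)
    have "(\<lambda>z. (1 - fst z / T) powr \<alpha> * f (snd z)) \<in> borel_measurable (borel \<Otimes>\<^sub>M borel)"
      by measurable
    then show "(\<lambda>z. (1 - fst z / T) powr \<alpha> * f (snd z)) \<in> borel_measurable lborel"
      by (simp add: borel_prod)
  qed
  have eq: "indicator ({0..T} \<times> UNIV) z *\<^sub>R (case z of (t, x) \<Rightarrow> \<bar>u t x\<bar> powr p * ((1 - t / T) powr \<alpha> * f x))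
      = (indicator K z *\<^sub>R (case z of (t, x) \<Rightarrow> \<bar>u t x\<bar> powr p)) * ((1 - fst z / T) powr \<alpha> * f (snd z))" for z
    using f by (auto simp: K_def bump_def indicator_def not_le split: prod.splits)
  have "integrable lebesgue (\<lambda>z. (indicator K z *\<^sub>R (case z of (t, x) \<Rightarrow> \<bar>u t x\<bar> powr p)) * ((1 - fst z / T) powr \<alpha> * f (snd z)))"
  proof (rule Bochner_Integration.integrable_bound[OF iK])
    show "AE z in lebesgue. norm ((indicator K z *\<^sub>R (case z of (t, x) \<Rightarrow> \<bar>u t x\<bar> powr p)) * ((1 - fst z / T) powr \<alpha> * f (snd z)))
        \<le> norm (indicator K z *\<^sub>R (case z of (t, x) \<Rightarrow> \<bar>u t x\<bar> powr p))"
    proof (intro AE_I2)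
      fix z :: "real \<times> (real^'a)"
      show "norm ((indicator K z *\<^sub>R (case z of (t, x) \<Rightarrow> \<bar>u t x\<bar> powr p)) * ((1 - fst z / T) powr \<alpha> * f (snd z)))
        \<le> norm (indicator K z *\<^sub>R (case z of (t, x) \<Rightarrow> \<bar>u t x\<bar> powr p))"
      proof (cases "z \<in> K")
        case True
        then have "(1 - fst z / T) powr \<alpha> \<le> 1"
          using assms(3,4) by (intro powr_le1) (auto simp: K_def)
        then have "\<bar>(1 - fst z / T) powr \<alpha> * f (snd z)\<bar> \<le> 1"
          using f by (auto simp: bump_def abs_mult intro!: mult_le_one)
        then show ?thesis
            unfolding norm_mult[of _ "(1 - fst z / T) powr \<alpha> * f (snd z)"] real_norm_def[of "(1 - fst z / T) powr \<alpha> * f (snd z)"]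
            by (rule mult_left_le) simp
      qed simp
    qed
    show "(\<lambda>z. (indicator K z *\<^sub>R (case z of (t, x) \<Rightarrow> \<bar>u t x\<bar> powr p)) * ((1 - fst z / T) powr \<alpha> * f (snd z)))
        \<in> borel_measurable lebesgue"
      by (intro borel_measurable_times borel_measurable_integrable[OF iK] wm)
  qed
  then show ?thesis unfolding set_integrable_def eq .
qed

lemma energy_mono:
  assumes "Lp_loc p u" "bump r f" "bump s g" "T > 0" "\<alpha> \<ge> 0" "\<And>x. f x \<le> g x"
  shows "energy p \<alpha> T u f \<le> energy p \<alpha> T u g"
  unfolding energy_def
  by (intro set_integral_mono energy_integrable[OF assms(1,2,4,5)] energy_integrable[OF assms(1,3,4,5)])
    (auto intro!: mult_left_mono assms(6))

lemma energy_add: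
  assumes "Lp_loc p u" "bump r f" "bump s g" "T > 0" "\<alpha> \<ge> 0"
  shows "energy p \<alpha> T u (\<lambda>x. f x + g x) = energy p \<alpha> T u f + energy p \<alpha> T u g"
  unfolding energy_def
  by (subst set_integral_add(2)[OF energy_integrable[OF assms(1,2,4,5)] energy_integrable[OF assms(1,3,4,5)], symmetric])
    (simp add: case_prod_unfold algebra_simps)

lemma energy_nonneg:
  assumes "bump r f"
  shows "0 \<le> energy p \<alpha> T u f"
  unfolding energy_def set_lebesgue_integral_def
  using assms by (intro integral_nonneg_AE AE_I2) (auto simp: bump_def split: prod.splits)

text \<open>
  The hypothesis on \<open>F\<close> says \<open>\<bar>F\<bar> \<le> c \<bar>u\<bar> w^(1/p)\<close> with the weight \<open>w = (1 - t/T)^\<alpha> f(x)\<close> of the energy. Young's inequality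
  with \<open>a = \<bar>u\<bar> w^(1/p)\<close> therefore gives the energy density plus a constant on the ball that carries \<open>f\<close>. As this majorant
  is integrable, the estimate holds for every \<open>F\<close>: if \<open>F\<close> is not integrable, its integral is \<open>0\<close> by convention.
\<close>
lemma energy_young:
  fixes u :: "real \<Rightarrow> real^'n::finite \<Rightarrow> real"
  assumes u: "Lp_loc p u" and f: "bump r f" and "T > 0" "\<alpha> \<ge> 0" "p > 1" "\<kappa> > 0" "c \<ge> 0"
    and F: "\<And>t x. t \<in> {0..T} \<Longrightarrow> \<bar>F t x\<bar> \<le> \<bar>u t x\<bar> * (c * ((1 - t / T) powr (\<alpha> / p) * f x powr (1 / p)))"
  shows "\<bar>LINT (t, x):{0..T} \<times> UNIV|lebesgue. F t x\<bar> \<le> \<kappa> * energy p \<alpha> T u f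
     + T * measure lebesgue (cball (0 :: real^'n) r) * (\<kappa> powr (- 1 / (p - 1)) * c powr (p / (p - 1)))"
proof -
  define D where "D = \<kappa> powr (- 1 / (p - 1)) * c powr (p / (p - 1))"
  have D: "D \<ge> 0" by (simp add: D_def)
  define E where "E = (\<lambda>(t, x). \<bar>u t x\<bar> powr p * ((1 - t / T) powr \<alpha> * f x))"
  define B where "B = (\<lambda>(t :: real, x :: real^'n). D * indicator (cball 0 r) x :: real)"
  have iE: "set_integrable lebesgue ({0..T} \<times> UNIV) E"
    unfolding E_def by (rule energy_integrable[OF u f assms(3,4)])
  have ic: "integrable lebesgue (indicator (cball (0 :: real^'n) r) :: _ \<Rightarrow> real)"
    using lmeasurable_cball[of "0 :: real^'n" r] by (intro integrable_real_indicator) (auto simp: fmeasurable_def)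
  have cont: "continuous_on {0..T} (\<lambda>_. D)" by simp
  have iB: "set_integrable lebesgue ({0..T} \<times> UNIV) B"
    unfolding B_def by (rule integral_product_time_space(1)[OF cont ic])
  have LB: "(LINT z:{0..T} \<times> UNIV|lebesgue. B z) = T * measure lebesgue (cball (0 :: real^'n) r) * D"
    unfolding B_def integral_product_time_space(2)[OF cont ic]
    using assms(3) by (simp add: set_integral_const mult_ac set_lebesgue_integral_def)
  have iEB: "set_integrable lebesgue ({0..T} \<times> UNIV) (\<lambda>z. \<kappa> * E z + B z)"
    by (rule set_integral_add(1)[OF set_integrable_mult_right[OF iE] iB])
  have pt: "\<bar>F t x\<bar> \<le> \<kappa> * E (t, x) + B (t, x)" if t: "t \<in> {0..T}" for t x
  proof (cases "norm x > r")
    case True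
    then have "f x = 0" using f by (simp add: bump_def)
    then show ?thesis using F[OF t, of x] D assms(6) by (simp add: E_def B_def)
  next
    case False
    have fx: "f x \<ge> 0" using f by (simp add: bump_def)
    have "\<bar>F t x\<bar> \<le> (\<bar>u t x\<bar> * ((1 - t / T) powr (\<alpha> / p) * f x powr (1 / p))) * c"
      using F[OF t, of x] by (simp add: mult_ac)
    also have "\<dots> \<le> \<kappa> * (\<bar>u t x\<bar> * ((1 - t / T) powr (\<alpha> / p) * f x powr (1 / p))) powr p + D"
      unfolding D_def using assms by (intro weighted_young) auto
    also have "(\<bar>u t x\<bar> * ((1 - t / T) powr (\<alpha> / p) * f x powr (1 / p))) powr p = E (t, x)"
      using assms(5) fx by (simp add: E_def powr_mult powr_powr)
    finally show ?thesis using False by (simp add: B_def)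
  qed
  have "\<bar>LINT (t, x):{0..T} \<times> UNIV|lebesgue. F t x\<bar>
      \<le> (LINT z|lebesgue. norm (indicator ({0..T} \<times> UNIV) z *\<^sub>R (case z of (t, x) \<Rightarrow> F t x)))"
    unfolding set_lebesgue_integral_def real_norm_def[symmetric, of "integral\<^sup>L _ _"]
    by (rule integral_norm_bound)
  also have "\<dots> \<le> (LINT z:{0..T} \<times> UNIV|lebesgue. \<kappa> * E z + B z)"
    unfolding set_lebesgue_integral_def
  proof (rule integral_mono')
    show "integrable lebesgue (\<lambda>z. indicator ({0..T} \<times> UNIV) z *\<^sub>R (\<kappa> * E z + B z))"
      using iEB by (simp only: set_integrable_def)
    fix z :: "real \<times> (real^'n)"
    obtain t x where z: "z = (t, x)" by fastforce
    show "norm (indicator ({0..T} \<times> UNIV) z *\<^sub>R (case z of (t, x) \<Rightarrow> F t x))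
       \<le> indicator ({0..T} \<times> UNIV) z *\<^sub>R (\<kappa> * E z + B z)"
      using pt[of t x] by (auto simp: z indicator_def)
    show "0 \<le> indicator ({0..T} \<times> UNIV) z *\<^sub>R (\<kappa> * E z + B z)"
      using pt[of t x] by (auto simp: z indicator_def)
  qed
  also have "\<dots> = \<kappa> * (LINT z:{0..T} \<times> UNIV|lebesgue. E z) + (LINT z:{0..T} \<times> UNIV|lebesgue. B z)"
    by (subst set_integral_add(2)[OF set_integrable_mult_right[OF iE] iB]) simp
  finally show ?thesis by (simp add: LB energy_def E_def D_def)
qed

section \<open>The energy inequality for cutoffs\<close>

abbreviation shell :: "real \<Rightarrow> (real^'n::finite) set" where
  "shell R \<equiv> {x. R < norm x \<and> norm x \<le> 2 * R}"

abbreviation shell_cutoff :: "nat \<Rightarrow> real \<Rightarrow> real^'n::finite \<Rightarrow> real" where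
  "shell_cutoff m R x \<equiv> indicator (shell R) x * cutoff m R x"

lemma cutoff_borel: "R > 0 \<Longrightarrow> m \<ge> 3 \<Longrightarrow> cutoff m R \<in> borel_measurable borel"
  by (intro borel_measurable_continuous_onI cutoff_C2)

lemma bump_cutoff:
  assumes "R > 0" "m \<ge> 3"
  shows "bump (2 * R) (cutoff m R)"
  using assms cutoff_borel[OF assms] unfolding bump_def
  by (auto simp: cutoff_nonneg cutoff_le_1 cutoff_eq_0)

lemma bump_shell_cutoff:
  assumes "R > 0" "m \<ge> 3"
  shows "bump (2 * R) (shell_cutoff m R)"
proof -
  have [measurable]: "cutoff m R \<in> borel_measurable borel" by (rule cutoff_borel[OF assms])
  have "shell_cutoff m R \<in> borel_measurable borel" by measurable
  then show ?thesis
    using assms unfolding bump_def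
    by (auto simp: cutoff_nonneg cutoff_le_1 indicator_def)
qed

lemma bump_ball: "bump r (indicator (cball 0 r))"
  unfolding bump_def by (auto simp: indicator_def intro!: borel_measurable_indicator borel_closed)

lemma power_le_powr:
  fixes y r :: real
  assumes "0 \<le> y" "y \<le> 1" "r \<le> real n" "n > 0"
  shows "y ^ n \<le> y powr r"
proof (cases "y = 0")
  case False
  then have "y ^ n = y powr real n" using assms by (simp add: powr_realpow)
  also have "\<dots> \<le> y powr r" using assms False by (intro powr_mono') auto
  finally show ?thesis .
qed (use assms in \<open>simp add: power_0_left\<close>)

text \<open>
  The condition on \<open>m\<close> in \<open>cutoff_laplacian_bound\<close> can be met because \<open>1/p < 1\<close>.
\<close>
lemma cutoff_exponent:
  fixes p :: real
  assumes "p > 1"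
  obtains m :: nat where "m \<ge> 3" "real m / p \<le> real m - 2"
proof -
  obtain n :: nat where n: "2 * p / (p - 1) \<le> real n" using real_arch_simple by blast
  define m where "m = max 3 n"
  have "2 * p / (p - 1) \<le> real m" using n by (simp add: m_def)
  then have "real m / p \<le> real m - 2" using assms by (simp add: field_simps)
  then show ?thesis by (intro that[of m]) (simp_all add: m_def)
qed

text \<open>
  The weak formulation for \<open>\<phi>(t, x) = (1 - t/T)^m \<xi>(x)\<close>. Each of the integrals of \<open>u \<phi>\<^sub>t\<close>, \<open>k u \<Delta>\<phi>\<^sub>t\<close> and
  \<open>u \<Delta>\<phi>\<close> is estimated by \<open>energy_young\<close>. The first one involves \<open>\<xi>\<close> itself and gets the Young constant \<open>\<kappa>\<close>; the
  other two live on the shell, outside which \<open>\<Delta>\<xi>\<close> vanishes, and get the constant \<open>K\<close>. Keeping the shell separate is what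
  makes the critical case work. In time, \<open>\<phi>\<^sub>t\<close> has the factor \<open>(1 - t/T)^(m-1)\<close>, which is below the \<open>p\<close>-th root
  \<open>(1 - t/T)^((m+\<gamma>)/p)\<close> of the weight since \<open>m/p \<le> m - 2\<close> and \<open>\<gamma>/p \<le> 1\<close>.
\<close>
lemma cutoff_energy_inequality:
  fixes u :: "real \<Rightarrow> real^'n::finite \<Rightarrow> real"
  assumes sol: "global_weak_solution k p \<gamma> u0 \<omega> u" and \<omega>: "integrable lebesgue \<omega>"
    and "k \<ge> 0" "p > 1" "0 \<le> \<gamma>" "\<gamma> < 1" "T > 0" "R > 0" "\<kappa> > 0" "K > 0"
    and m: "m \<ge> 3" "real m / p \<le> real m - 2"
  defines "d \<equiv> 246 * real CARD('n) * (real m)\<^sup>2 / R\<^sup>2"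
  shows "RL_power_const \<gamma> m * T powr \<gamma> * energy p (real m + \<gamma>) T u (cutoff m R)
      + T / (real m + 1) * (LINT x|lebesgue. \<omega> x * cutoff m R x)
      + (LINT x|lebesgue. u0 x * (cutoff m R x - k * laplacian (cutoff m R) x))
    \<le> \<kappa> * energy p (real m + \<gamma>) T u (cutoff m R)
      + 2 * K * energy p (real m + \<gamma>) T u (shell_cutoff m R)
      + T * measure lebesgue (cball (0 :: real^'n) (2 * R)) *
        (\<kappa> powr (- 1 / (p - 1)) * (real m / T) powr (p / (p - 1))
         + K powr (- 1 / (p - 1)) * ((k * (real m / T) * d) powr (p / (p - 1)) + d powr (p / (p - 1))))"
proof -
  let ?\<alpha> = "real m + \<gamma>" and ?S = "{0..T} \<times> (UNIV :: (real^'n) set)"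
  let ?V = "measure lebesgue (cball (0 :: real^'n) (2 * R))"
  define \<xi> where "\<xi> = (cutoff m R :: real^'n \<Rightarrow> real)"
  define \<phi> where "\<phi> = (\<lambda>t x. (1 - t / T) ^ m * \<xi> x)"
  have d: "d \<ge> 0" by (simp add: d_def)
  note test = test_function_cutoff[OF \<open>T > 0\<close> \<open>R > 0\<close> m(1), where ?'n = 'n, folded \<xi>_def, folded \<phi>_def]
  have Lp: "Lp_loc p u" using sol by (simp add: global_weak_solution_def)
  have "closed ?S" by (intro closed_Times) auto
  then have S: "?S \<in> sets lebesgue" by (intro sets_completionI_sets) (simp add: borel_closed)
  have \<xi>: "0 \<le> \<xi> x" "\<xi> x \<le> 1" for x
    using \<open>R > 0\<close> by (simp_all add: \<xi>_def cutoff_nonneg cutoff_le_1)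

  have "(LINT (t, x):?S|lebesgue. \<bar>u t x\<bar> powr p * RL_right \<gamma> T (\<lambda>s. \<phi> s x) t)
      = (LINT (t, x):?S|lebesgue. (RL_power_const \<gamma> m * T powr \<gamma>) *
          (\<bar>u t x\<bar> powr p * ((1 - t / T) powr ?\<alpha> * \<xi> x)))"
    using assms by (intro set_lebesgue_integral_cong S)
      (auto simp: \<phi>_def RL_right_mult RL_right_power)
  also have "\<dots> = (LINT z:?S|lebesgue. (RL_power_const \<gamma> m * T powr \<gamma>) *
          (case z of (t, x) \<Rightarrow> \<bar>u t x\<bar> powr p * ((1 - t / T) powr ?\<alpha> * \<xi> x)))"
    by (simp add: case_prod_unfold)
  also have "\<dots> = RL_power_const \<gamma> m * T powr \<gamma> * energy p ?\<alpha> T u \<xi>"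
    by (simp add: energy_def)
  finally have t1: "(LINT (t, x):?S|lebesgue. \<bar>u t x\<bar> powr p * RL_right \<gamma> T (\<lambda>s. \<phi> s x) t)
      = RL_power_const \<gamma> m * T powr \<gamma> * energy p ?\<alpha> T u \<xi>" .

  have "integrable lebesgue (\<lambda>x. \<omega> x * \<xi> x)"
  proof (rule Bochner_Integration.integrable_bound[OF \<omega>])
    have "\<xi> \<in> borel_measurable lebesgue"
      unfolding \<xi>_def using cutoff_borel[OF \<open>R > 0\<close> m(1)] by (intro measurable_completion) simp
    then show "(\<lambda>x. \<omega> x * \<xi> x) \<in> borel_measurable lebesgue"
      using borel_measurable_integrable[OF \<omega>] by (rule borel_measurable_times[rotated])
    show "AE x in lebesgue. norm (\<omega> x * \<xi> x) \<le> norm (\<omega> x)"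
      using \<xi> by (auto simp: abs_mult intro!: mult_left_le)
  qed
  moreover have "continuous_on {0..T} (\<lambda>t. (1 - t / T) ^ m)"
    using \<open>T > 0\<close> by (intro continuous_intros) auto
  ultimately have t2: "(LINT (t, x):?S|lebesgue. \<omega> x * \<phi> t x) = T / (real m + 1) * (LINT x|lebesgue. \<omega> x * \<xi> x)"
    using integral_product_time_space(2)[of T "\<lambda>t. (1 - t / T) ^ m" "\<lambda>x. \<omega> x * \<xi> x"]
    by (simp add: \<phi>_def integral_time_power[OF \<open>T > 0\<close>] mult_ac)

  have t3: "\<phi> 0 x - k * laplacian (\<phi> 0) x = \<xi> x - k * laplacian \<xi> x" for x
    using test(2)[of 0 x] \<open>T > 0\<close> by (simp add: \<phi>_def)

  have \<alpha>: "?\<alpha> / p \<le> real (m - 1)" "?\<alpha> / p \<le> real m"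
  proof -
    have "\<gamma> / p \<le> 1" using assms by (simp add: divide_le_eq)
    then show "?\<alpha> / p \<le> real (m - 1)" using m by (simp add: add_divide_distrib of_nat_diff)
    then show "?\<alpha> / p \<le> real m" by simp
  qed
  have \<tau>: "0 \<le> 1 - t / T" "1 - t / T \<le> 1"
      "(1 - t / T) ^ (m - 1) \<le> (1 - t / T) powr (?\<alpha> / p)" "(1 - t / T) ^ m \<le> (1 - t / T) powr (?\<alpha> / p)"
    if "t \<in> {0..T}" for t
    using that \<open>T > 0\<close> m \<alpha> by (auto intro!: power_le_powr simp del: of_nat_diff)
  have \<xi>p: "\<xi> x \<le> \<xi> x powr (1 / p)" for x
    using power_le_powr[of "\<xi> x" "1 / p" 1] \<xi> \<open>p > 1\<close> by simp
  have lap: "\<bar>laplacian \<xi> x\<bar> \<le> d * shell_cutoff m R x powr (1 / p)" for x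
    using cutoff_laplacian_bound[OF \<open>R > 0\<close> m(1) _ m(2), of x] \<open>p > 1\<close>
    by (auto simp: d_def \<xi>_def indicator_def split: if_splits)

  have b1: "\<bar>LINT (t, x):?S|lebesgue. u t x * time_deriv T \<phi> t x\<bar> \<le> \<kappa> * energy p ?\<alpha> T u \<xi>
     + T * ?V * (\<kappa> powr (- 1 / (p - 1)) * (real m / T) powr (p / (p - 1)))"
  proof (rule energy_young)
    fix t x assume t: "t \<in> {0..T}"
    have "(1 - t / T) ^ (m - 1) * \<xi> x \<le> (1 - t / T) powr (?\<alpha> / p) * \<xi> x powr (1 / p)"
      using \<tau>[OF t] \<xi> \<xi>p by (intro mult_mono) auto
    then have "\<bar>u t x\<bar> * (real m / T * ((1 - t / T) ^ (m - 1) * \<xi> x))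
        \<le> \<bar>u t x\<bar> * (real m / T * ((1 - t / T) powr (?\<alpha> / p) * \<xi> x powr (1 / p)))"
      using \<open>T > 0\<close> by (intro mult_left_mono) auto
    moreover have "\<bar>u t x * time_deriv T \<phi> t x\<bar> = \<bar>u t x\<bar> * (real m / T * ((1 - t / T) ^ (m - 1) * \<xi> x))"
      using \<tau>[OF t] \<xi> \<open>T > 0\<close> unfolding \<phi>_def time_deriv_power(1)[OF \<open>T > 0\<close> t]
      by (simp add: abs_mult)
    ultimately show "\<bar>u t x * time_deriv T \<phi> t x\<bar>
        \<le> \<bar>u t x\<bar> * (real m / T * ((1 - t / T) powr (?\<alpha> / p) * \<xi> x powr (1 / p)))" by simp
  qed (use assms bump_cutoff[OF \<open>R > 0\<close> m(1)] Lp in \<open>auto simp: \<xi>_def\<close>)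

  have lap_bound: "\<bar>u t x * (c * \<tau>' * laplacian \<xi> x)\<bar>
      \<le> \<bar>u t x\<bar> * (c * d * ((1 - t / T) powr (?\<alpha> / p) * shell_cutoff m R x powr (1 / p)))"
    if "c \<ge> 0" "0 \<le> \<tau>'" "\<tau>' \<le> (1 - t / T) powr (?\<alpha> / p)" for t x c \<tau>'
  proof -
    have "\<tau>' * \<bar>laplacian \<xi> x\<bar> \<le> (1 - t / T) powr (?\<alpha> / p) * (d * shell_cutoff m R x powr (1 / p))"
      using that lap by (intro mult_mono) auto
    then have "\<bar>u t x\<bar> * (c * (\<tau>' * \<bar>laplacian \<xi> x\<bar>))
        \<le> \<bar>u t x\<bar> * (c * ((1 - t / T) powr (?\<alpha> / p) * (d * shell_cutoff m R x powr (1 / p))))"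
      using that by (intro mult_left_mono) auto
    then show ?thesis using that by (simp add: abs_mult mult_ac)
  qed

  have "\<bar>LINT (t, x):?S|lebesgue. k * (u t x * laplacian (time_deriv T \<phi> t) x)\<bar>
    \<le> K * energy p ?\<alpha> T u (shell_cutoff m R)
     + T * ?V * (K powr (- 1 / (p - 1)) * (k * (real m / T) * d) powr (p / (p - 1)))"
  proof (rule energy_young)
    fix t x assume t: "t \<in> {0..T}"
    have "k * (u t x * laplacian (time_deriv T \<phi> t) x)
        = - (u t x * (k * (real m / T) * (1 - t / T) ^ (m - 1) * laplacian \<xi> x))"
      unfolding test(3)[OF t] by simp
    then show "\<bar>k * (u t x * laplacian (time_deriv T \<phi> t) x)\<bar>
      \<le> \<bar>u t x\<bar> * (k * (real m / T) * d * ((1 - t / T) powr (?\<alpha> / p) * shell_cutoff m R x powr (1 / p)))"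
      using lap_bound[of "k * (real m / T)" "(1 - t / T) ^ (m - 1)" t x] \<tau>[OF t] assms(3) \<open>T > 0\<close>
      by (simp only: abs_minus) auto
  qed (use assms d bump_shell_cutoff[OF \<open>R > 0\<close> m(1)] Lp in auto)
  moreover have "(LINT (t, x):?S|lebesgue. k * (u t x * laplacian (time_deriv T \<phi> t) x))
     = k * (LINT (t, x):?S|lebesgue. u t x * laplacian (time_deriv T \<phi> t) x)"
    by (subst set_integral_mult_right[symmetric]) (simp add: case_prod_unfold)
  ultimately have b2: "\<bar>k * (LINT (t, x):?S|lebesgue. u t x * laplacian (time_deriv T \<phi> t) x)\<bar>
    \<le> K * energy p ?\<alpha> T u (shell_cutoff m R)
     + T * ?V * (K powr (- 1 / (p - 1)) * (k * (real m / T) * d) powr (p / (p - 1)))" by simp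

  have b3: "\<bar>LINT (t, x):?S|lebesgue. u t x * laplacian (\<phi> t) x\<bar>
    \<le> K * energy p ?\<alpha> T u (shell_cutoff m R)
     + T * ?V * (K powr (- 1 / (p - 1)) * d powr (p / (p - 1)))"
  proof (rule energy_young)
    fix t x assume t: "t \<in> {0..T}"
    show "\<bar>u t x * laplacian (\<phi> t) x\<bar>
      \<le> \<bar>u t x\<bar> * (d * ((1 - t / T) powr (?\<alpha> / p) * shell_cutoff m R x powr (1 / p)))"
      using lap_bound[of 1 "(1 - t / T) ^ m" t x] \<tau>[OF t] test(2)[OF t, of x] by (simp add: \<phi>_def)
  qed (use assms d bump_shell_cutoff[OF \<open>R > 0\<close> m(1)] Lp in auto)

  have "RL_power_const \<gamma> m * T powr \<gamma> * energy p ?\<alpha> T u \<xi>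
      + T / (real m + 1) * (LINT x|lebesgue. \<omega> x * \<xi> x)
      + (LINT x|lebesgue. u0 x * (\<xi> x - k * laplacian \<xi> x))
      = - (LINT (t, x):?S|lebesgue. u t x * time_deriv T \<phi> t x)
          + k * (LINT (t, x):?S|lebesgue. u t x * laplacian (time_deriv T \<phi> t) x)
          - (LINT (t, x):?S|lebesgue. u t x * laplacian (\<phi> t) x)"
    using sol test(1) \<open>T > 0\<close> unfolding global_weak_solution_def t1[symmetric] t2[symmetric] t3[symmetric]
    by blast
  also have "\<dots> \<le> (\<kappa> * energy p ?\<alpha> T u \<xi>
     + T * ?V * (\<kappa> powr (- 1 / (p - 1)) * (real m / T) powr (p / (p - 1))))
     + (K * energy p ?\<alpha> T u (shell_cutoff m R)
     + T * ?V * (K powr (- 1 / (p - 1)) * (k * (real m / T) * d) powr (p / (p - 1))))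
     + (K * energy p ?\<alpha> T u (shell_cutoff m R)
     + T * ?V * (K powr (- 1 / (p - 1)) * d powr (p / (p - 1))))"
    using b1 b2 b3 by linarith
  also have "\<dots> = \<kappa> * energy p ?\<alpha> T u \<xi> + 2 * K * energy p ?\<alpha> T u (shell_cutoff m R)
      + T * ?V * (\<kappa> powr (- 1 / (p - 1)) * (real m / T) powr (p / (p - 1))
         + K powr (- 1 / (p - 1)) * ((k * (real m / T) * d) powr (p / (p - 1)) + d powr (p / (p - 1))))"
    by (simp add: algebra_simps)
  finally show ?thesis unfolding \<xi>_def .
qed

section \<open>Nonexistence\<close>

lemma integral_cutoff_tendsto:
  fixes \<omega> :: "real^'n::finite \<Rightarrow> real"
  assumes \<omega>: "integrable lebesgue \<omega>" and m: "m \<ge> 3"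
  shows "((\<lambda>R. LINT x|lebesgue. \<omega> x * cutoff m R x) \<longlongrightarrow> (LINT x|lebesgue. \<omega> x)) at_top"
proof -
  have "((\<lambda>R. LINT x|lebesgue. \<omega> x * cutoff m (max 1 R) x) \<longlongrightarrow> (LINT x|lebesgue. \<omega> x)) at_top"
  proof (rule integral_dominated_convergence_at_top[where w = "\<lambda>x. norm (\<omega> x)"])
    show "\<omega> \<in> borel_measurable lebesgue" using \<omega> by simp
    show "(\<lambda>x. \<omega> x * cutoff m (max 1 R) x) \<in> borel_measurable lebesgue" for R
    proof -
      have "(cutoff m (max 1 R) :: real^'n \<Rightarrow> real) \<in> borel_measurable lebesgue"
        using m by (intro measurable_completion) (simp add: cutoff_borel)
      then show ?thesis
        using borel_measurable_integrable[OF \<omega>] by (rule borel_measurable_times[rotated])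
    qed
    show "integrable lebesgue (\<lambda>x. norm (\<omega> x))" using \<omega> by simp
    show "\<forall>\<^sub>F R in at_top. AE x in lebesgue. norm (\<omega> x * cutoff m (max 1 R) x) \<le> norm (\<omega> x)"
      by (intro always_eventually allI AE_I2)
        (auto simp: abs_mult cutoff_nonneg cutoff_le_1 intro!: mult_left_le)
    show "AE x in lebesgue. ((\<lambda>R. \<omega> x * cutoff m (max 1 R) x) \<longlongrightarrow> \<omega> x) at_top"
    proof (rule AE_I2)
      fix x :: "real^'n"
      have "\<forall>\<^sub>F R in at_top. \<omega> x = \<omega> x * cutoff m (max 1 R) x"
        using eventually_ge_at_top[of "norm x"] by eventually_elim (simp add: cutoff_eq_1)
      then show "((\<lambda>R. \<omega> x * cutoff m (max 1 R) x) \<longlongrightarrow> \<omega> x) at_top"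
        by (rule Lim_transform_eventually[OF tendsto_const])
    qed
  qed
  moreover have "\<forall>\<^sub>F R in at_top. (LINT x|lebesgue. \<omega> x * cutoff m (max 1 R) x) = (LINT x|lebesgue. \<omega> x * cutoff m R x)"
    using eventually_ge_at_top[of 1] by eventually_elim (simp add: max_def)
  ultimately show ?thesis by (rule Lim_transform_eventually)
qed

lemma time_error_tendsto_0:
  fixes q :: real
  assumes "q > 0" "a \<ge> 0"
  shows "((\<lambda>T. (a / T) powr q) \<longlongrightarrow> 0) at_top"
proof (rule tendsto_zero_powrI)
  show "((\<lambda>T. a / T) \<longlongrightarrow> 0) at_top"
    by (rule tendsto_divide_0[OF tendsto_const filterlim_at_top_imp_at_infinity[OF filterlim_ident]])
  show "\<forall>\<^sub>F T in at_top. 0 \<le> a / T"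
    using eventually_gt_at_top[of 0] by eventually_elim (simp add: assms)
qed (use assms in auto)

text \<open>
  Here \<open>\<kappa> + 2K\<close> is chosen as the coefficient \<open>c T^\<gamma>\<close> of the energy, so that the energy disappears from the
  inequality. The Young constants then contribute powers of \<open>T\<close> with the negative exponent \<open>-\<gamma>/(p-1)\<close>, which beat the fixed
  spatial error. Dividing by \<open>T\<close> and letting \<open>T\<close> grow bounds the integral of \<open>\<omega>\<xi>\<close> by \<open>0\<close>.
\<close>
lemma no_global_weak_solution_fractional:
  fixes u0 \<omega> :: "real^'n::finite \<Rightarrow> real"
  assumes "k \<ge> 0" "p > 1" "0 < \<gamma>" "\<gamma> < 1" and \<omega>: "integrable lebesgue \<omega>" "(LINT x|lebesgue. \<omega> x) > 0"
  shows "\<not> global_weak_solution k p \<gamma> u0 \<omega> u"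
proof
  assume sol: "global_weak_solution k p \<gamma> u0 \<omega> u"
  then have Lp: "Lp_loc p u" by (simp add: global_weak_solution_def)
  obtain m where m: "m \<ge> 3" "real m / p \<le> real m - 2"
    using cutoff_exponent[OF \<open>p > 1\<close>] by blast
  define q s where "q = p / (p - 1)" and "s = - 1 / (p - 1)"
  have q: "q > 0" and s: "s < 0" using \<open>p > 1\<close> by (auto simp: q_def s_def field_simps)
  define J where "J R = (LINT x|lebesgue. \<omega> x * cutoff m R x)" for R
  have "\<forall>\<^sub>F R in at_top. J R > 0"
    unfolding J_def by (rule order_tendstoD(1)[OF integral_cutoff_tendsto[OF \<omega>(1) m(1)] \<omega>(2)])
  then have "\<forall>\<^sub>F R in at_top. J R > 0 \<and> R > 0"
    using eventually_gt_at_top by (rule eventually_conj)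
  then obtain R where R: "J R > 0" "R > 0"
    using eventually_happens'[OF trivial_limit_at_top_linorder] by blast
  define d where "d = 246 * real CARD('n) * (real m)\<^sup>2 / R\<^sup>2"
  have d: "d \<ge> 0" by (simp add: d_def)
  define U where "U = (LINT x|lebesgue. u0 x * (cutoff m R x - k * laplacian (cutoff m R) x))"
  define V where "V = measure lebesgue (cball (0 :: real^'n) (2 * R))"
  define c where "c = RL_power_const \<gamma> m"
  have c: "c > 0" using assms by (simp add: c_def RL_power_const_pos)
  \<comment> \<open>All error terms divided by \<open>T\<close>, with \<open>\<kappa> = c T^\<gamma>/2\<close> and \<open>K = c T^\<gamma>/4\<close>.\<close>
  define err where "err T = - U / T + V * ((c / 2 * T powr \<gamma>) powr s * (real m / T) powr q
      + (c / 4 * T powr \<gamma>) powr s * ((k * real m * d / T) powr q + d powr q))" for T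
  have "J R / (real m + 1) \<le> err T" if T: "T > 0" for T
  proof -
    define L where "L = c * T powr \<gamma>"
    have L: "L > 0" using c T by (simp add: L_def)
    let ?e = "energy p (real m + \<gamma>) T u"
    have "?e (shell_cutoff m R) \<le> ?e (cutoff m R)"
      using assms R m T by (intro energy_mono[OF Lp bump_shell_cutoff bump_cutoff])
        (auto simp: indicator_def cutoff_nonneg)
    then have "2 * (L / 4) * ?e (shell_cutoff m R) \<le> L / 2 * ?e (cutoff m R)"
      using L by simp
    moreover have "L * ?e (cutoff m R) + T / (real m + 1) * J R + U
      \<le> L / 2 * ?e (cutoff m R) + 2 * (L / 4) * ?e (shell_cutoff m R)
        + T * V * ((L / 2) powr s * (real m / T) powr q
         + (L / 4) powr s * ((k * (real m / T) * d) powr q + d powr q))"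
      using cutoff_energy_inequality[OF sol \<omega>(1) _ _ _ _ T R(2) _ _ m, of "L / 2" "L / 4"] assms L
      unfolding J_def U_def V_def q_def s_def d_def L_def c_def by simp
    ultimately have "T / (real m + 1) * J R + U \<le> T * V * ((L / 2) powr s * (real m / T) powr q
         + (L / 4) powr s * ((k * (real m / T) * d) powr q + d powr q))" by linarith
    then have "T * (J R / (real m + 1)) \<le> T * err T"
      using T by (simp add: err_def L_def algebra_simps)
    then show ?thesis using T by (rule mult_left_le_imp_le)
  qed
  moreover have "(err \<longlongrightarrow> - 0 + V * (0 * 0 + 0 * (0 + d powr q))) at_top"
  proof -
    have P: "((\<lambda>T. (a * T powr \<gamma>) powr s) \<longlongrightarrow> 0) at_top" if "a > 0" for a
    proof -
      have "((\<lambda>T. a powr s * T powr (\<gamma> * s)) \<longlongrightarrow> a powr s * 0) at_top"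
        using assms(3) s by (intro tendsto_mult tendsto_const tendsto_neg_powr[OF _ filterlim_ident])
          (auto intro: mult_pos_neg)
      then show ?thesis using that by (simp add: powr_mult powr_powr)
    qed
    have "((\<lambda>T. - U / T) \<longlongrightarrow> - 0) at_top"
      using tendsto_minus[OF tendsto_divide_0[OF tendsto_const filterlim_at_top_imp_at_infinity[OF filterlim_ident], of U]]
      by simp
    then show ?thesis unfolding err_def[abs_def]
      using c d assms
      by (intro tendsto_add tendsto_mult tendsto_const P time_error_tendsto_0[OF q]) auto
  qed
  ultimately have "J R / (real m + 1) \<le> 0"
    by (intro tendsto_lowerbound[where f = err and F = at_top])
      (auto intro: eventually_mono[OF eventually_gt_at_top[of 0]])
  then show False using R by (simp add: divide_le_0_iff)
qed

text \<open>
  The bound \<open>upper\<close> on the energy of all of \<open>\<xi>\<close> and the bound \<open>shell\<close> from below on one shell are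
  incompatible once the shells are added up in \<open>chain\<close>. Both hold for \<open>T\<close> beyond a threshold that depends on \<open>R\<close>, so
  the number \<open>M\<close> of shells is fixed first and \<open>T\<close> is chosen last.
\<close>
lemma no_global_weak_solution_critical:
  fixes u0 \<omega> :: "real^'n::finite \<Rightarrow> real"
  assumes "k \<ge> 0" and N: "CARD('n) \<ge> 3" and p: "p = real CARD('n) / (real CARD('n) - 2)"
    and \<omega>: "integrable lebesgue \<omega>" "(LINT x|lebesgue. \<omega> x) > 0"
  shows "\<not> global_weak_solution k p 0 u0 \<omega> u"
proof
  assume sol: "global_weak_solution k p 0 u0 \<omega> u"
  then have Lp: "Lp_loc p u" by (simp add: global_weak_solution_def)
  have p1: "p > 1" using N by (simp add: p field_simps)
  obtain m where m: "m \<ge> 3" "real m / p \<le> real m - 2"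
    using cutoff_exponent[OF p1] by blast
  define q s where "q = p / (p - 1)" and "s = - 1 / (p - 1)"
  have q: "q = real CARD('n) / 2" "q > 0" using N by (auto simp: q_def p field_simps)
  have s: "s < 0" using p1 by (simp add: s_def)
  define J where "J R = (LINT x|lebesgue. \<omega> x * cutoff m R x)" for R
  define J0 where "J0 = (LINT x|lebesgue. \<omega> x)"
  have J0: "J0 > 0" using \<omega>(2) by (simp add: J0_def)
  have "\<forall>\<^sub>F R in at_top. J R > J0 / 2"
    unfolding J_def using \<omega>(2)
    by (intro order_tendstoD(1)[OF integral_cutoff_tendsto[OF \<omega>(1) m(1)]]) (simp add: J0_def)
  then obtain R1 where R1: "\<And>R. R \<ge> R1 \<Longrightarrow> J R > J0 / 2"
    unfolding eventually_at_top_linorder by blast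
  define R0 where "R0 = max 1 R1"
  have R0: "R0 > 0" "\<And>R. R \<ge> R0 \<Longrightarrow> J R > J0 / 2"
    using R1 by (auto simp: R0_def)
  define d where "d R = 246 * real CARD('n) * (real m)\<^sup>2 / R\<^sup>2" for R
  define V where "V R = measure lebesgue (cball (0 :: real^'n) (2 * R))" for R
  define U where "U R = (LINT x|lebesgue. u0 x * (cutoff m R x - k * laplacian (cutoff m R) x))" for R
  define D where "D = V 1 * d 1 powr q"
  have D: "D \<ge> 0" by (simp add: D_def V_def)
  \<comment> \<open>This is where criticality enters: \<open>R^N\<close> from the volume cancels \<open>R^(-2q)\<close> from \<open>d R powr q\<close>.\<close>
  have VD: "V R * d R powr q = D" if "R > 0" for R
  proof -
    have "V R = R ^ CARD('n) * V 1"
      using that content_ball_conv_unit_ball[of "2 * R" "0 :: real^'n"] content_ball_conv_unit_ball[of 2 "0 :: real^'n"]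
      by (simp add: V_def content_cball_conv_ball power_mult_distrib)
    moreover have "d R = d 1 * R powr (- 2)"
      using that by (simp add: d_def powr_minus powr_numeral divide_inverse)
    then have "d R powr q = d 1 powr q * (R powr (- 2)) powr q"
      by (simp add: powr_mult d_def)
    moreover have "(R powr (- 2)) powr q = R powr (- real CARD('n))"
      by (simp add: powr_powr q)
    moreover have "R ^ CARD('n) * R powr (- real CARD('n)) = 1"
      using that by (simp add: powr_minus powr_realpow)
    ultimately show ?thesis by (simp add: D_def)
  qed
  define e where "e T f = energy p (real m) T u f" for T and f :: "real^'n \<Rightarrow> real"
  \<comment> \<open>The errors, divided by \<open>T\<close>, that vanish as \<open>T\<close> grows; the critical one is kept apart as \<open>K powr s * D\<close>.\<close>
  define err where "err \<kappa> K R T = - U R / T + V R * (\<kappa> powr s * (real m / T) powr q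
      + K powr s * (k * real m * d R / T) powr q)" for \<kappa> K R T
  have err: "(err \<kappa> K R \<longlongrightarrow> 0) at_top" for \<kappa> K R
  proof -
    have "((\<lambda>T. - U R / T) \<longlongrightarrow> 0) at_top"
      by (rule tendsto_divide_0[OF tendsto_const filterlim_at_top_imp_at_infinity[OF filterlim_ident]])
    then have "(err \<kappa> K R \<longlongrightarrow> 0 + V R * (\<kappa> powr s * 0 + K powr s * 0)) at_top"
      unfolding err_def[abs_def] using assms(1)
      by (intro tendsto_add tendsto_mult tendsto_const time_error_tendsto_0[OF q(2)]) (auto simp: d_def)
    then show ?thesis by simp
  qed
  have core: "e T (cutoff m R) + T * (J R / (real m + 1))
      \<le> \<kappa> * e T (cutoff m R) + 2 * K * e T (shell_cutoff m R) + T * (err \<kappa> K R T + K powr s * D)"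
    if "T > 0" "R > 0" "\<kappa> > 0" "K > 0" for T R \<kappa> K
  proof -
    have "Gamma (real m + 1) \<noteq> 0" using Gamma_real_pos[of "real m + 1"] by linarith
    then have "e T (cutoff m R) + T / (real m + 1) * J R + U R
      \<le> \<kappa> * e T (cutoff m R) + 2 * K * e T (shell_cutoff m R)
        + T * V R * (\<kappa> powr s * (real m / T) powr q
         + K powr s * ((k * (real m / T) * d R) powr q + d R powr q))"
      using cutoff_energy_inequality[OF sol \<omega>(1) assms(1) p1 _ _ that m] that
      unfolding J_def U_def V_def q_def s_def d_def e_def by (simp add: RL_power_const_def)
    moreover have "T * V R * (\<kappa> powr s * (real m / T) powr q
         + K powr s * ((k * (real m / T) * d R) powr q + d R powr q)) - U R = T * (err \<kappa> K R T + K powr s * D)"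
      unfolding VD[OF that(2), symmetric] using that by (simp add: err_def field_simps)
    ultimately show ?thesis by simp
  qed

  \<comment> \<open>With \<open>\<kappa> = 1/4\<close> and \<open>K = 1/8\<close> at most half of the energy is needed on the right-hand side.\<close>
  define H where "H = 2 * (1 + (1 / 8) powr s * D)"
  have upper: "\<forall>\<^sub>F T in at_top. e T (cutoff m R) \<le> H * T" if R: "R \<ge> R0" for R
  proof -
    have Rpos: "R > 0" using R R0 by simp
    have "\<forall>\<^sub>F T in at_top. err (1 / 4) (1 / 8) R T < 1" by (rule order_tendstoD(2)[OF err]) simp
    then show ?thesis using eventually_gt_at_top[of 0]
    proof eventually_elim
      case (elim T)
      have "e T (shell_cutoff m R) \<le> e T (cutoff m R)"
        unfolding e_def using elim Rpos m
        by (intro energy_mono[OF Lp bump_shell_cutoff bump_cutoff]) (auto simp: indicator_def cutoff_nonneg)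
      moreover have "0 \<le> T * (J R / (real m + 1))"
        using R0(2)[OF R] J0 elim by simp
      moreover have "T * (err (1 / 4) (1 / 8) R T + (1 / 8) powr s * D) \<le> T * (1 + (1 / 8) powr s * D)"
        using elim by (intro mult_left_mono) auto
      moreover have "e T (cutoff m R) + T * (J R / (real m + 1))
          \<le> 1 / 4 * e T (cutoff m R) + 2 * (1 / 8) * e T (shell_cutoff m R)
            + T * (err (1 / 4) (1 / 8) R T + (1 / 8) powr s * D)"
        using elim Rpos by (intro core) auto
      ultimately have "e T (cutoff m R) \<le> 2 * (T * (1 + (1 / 8) powr s * D))"
        by linarith
      then show ?case by (simp add: H_def mult_ac)
    qed
  qed

  \<comment> \<open>Four units \<open>\<eta>\<close> are available from the source; the time error and the shell error cost one unit each.\<close>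
  define \<eta> where "\<eta> = J0 / (8 * (real m + 1))"
  have \<eta>: "\<eta> > 0" using J0 by (simp add: \<eta>_def)
  obtain K where K: "K > 0" "K powr s * D \<le> \<eta>"
  proof -
    have "((\<lambda>K. K powr s * D) \<longlongrightarrow> 0 * D) at_top"
      by (intro tendsto_mult tendsto_const tendsto_neg_powr[OF s filterlim_ident])
    then have "\<forall>\<^sub>F K in at_top. K powr s * D < \<eta>" using \<eta> by (intro order_tendstoD(2)) auto
    then have "\<forall>\<^sub>F K in at_top. K powr s * D < \<eta> \<and> K > 0" using eventually_gt_at_top by (rule eventually_conj)
    then obtain K where "K powr s * D < \<eta> \<and> K > 0"
      using eventually_happens'[OF trivial_limit_at_top_linorder] by blast
    then show ?thesis by (intro that[of K]) auto
  qed
  define \<delta> where "\<delta> = \<eta> / K"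
  have \<delta>: "\<delta> > 0" using \<eta> K by (simp add: \<delta>_def)
  have shell: "\<forall>\<^sub>F T in at_top. \<delta> * T \<le> e T (shell_cutoff m R)" if R: "R \<ge> R0" for R
  proof -
    have Rpos: "R > 0" using R R0 by simp
    have "\<forall>\<^sub>F T in at_top. err 1 K R T < \<eta>" by (rule order_tendstoD(2)[OF err \<eta>])
    then show ?thesis using eventually_gt_at_top[of 0]
    proof eventually_elim
      case (elim T)
      have "4 * \<eta> = J0 / 2 / (real m + 1)" by (simp add: \<eta>_def field_simps)
      also have "\<dots> \<le> J R / (real m + 1)" using R0(2)[OF R] by (intro divide_right_mono) auto
      finally have "4 * \<eta> \<le> J R / (real m + 1)" .
      then have "T * (4 * \<eta>) \<le> T * (J R / (real m + 1))" using elim by (intro mult_left_mono) auto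
      moreover have "T * (err 1 K R T + K powr s * D) \<le> T * (\<eta> + \<eta>)"
        using elim K by (intro mult_left_mono add_mono) auto
      moreover have "e T (cutoff m R) + T * (J R / (real m + 1))
          \<le> 1 * e T (cutoff m R) + 2 * K * e T (shell_cutoff m R) + T * (err 1 K R T + K powr s * D)"
        using elim Rpos K by (intro core) auto
      ultimately have "T * (4 * \<eta>) \<le> 2 * K * e T (shell_cutoff m R) + T * (\<eta> + \<eta>)"
        by linarith
      then have "\<eta> * T \<le> K * e T (shell_cutoff m R)" by (simp add: algebra_simps)
      then show ?case using K by (simp add: \<delta>_def field_simps)
    qed
  qed

  \<comment> \<open>Energies of balls telescope over the dyadic shells.\<close>
  define G where "G T r = e T (indicator (cball 0 r))" for T r
  have step: "G T R + e T (shell_cutoff m R) \<le> G T (2 * R)" if "T > 0" "R > 0" for T R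
  proof -
    have sum: "bump (2 * R) (\<lambda>x :: real^'n. indicator (cball 0 R) x + shell_cutoff m R x)"
      unfolding bump_def
    proof (intro conjI allI impI)
      have "(indicator (cball 0 R) :: real^'n \<Rightarrow> real) \<in> borel_measurable borel"
        "(shell_cutoff m R :: real^'n \<Rightarrow> real) \<in> borel_measurable borel"
        using bump_ball[of R, where ?'a = 'n] bump_shell_cutoff[OF that(2) m(1), where ?'a = 'n]
        by (auto simp only: bump_def)
      then show "(\<lambda>x :: real^'n. indicator (cball 0 R) x + shell_cutoff m R x) \<in> borel_measurable borel"
        by (rule borel_measurable_add)
    qed (use that(2) in \<open>auto simp: indicator_def cutoff_nonneg cutoff_le_1\<close>)
    have "G T R + e T (shell_cutoff m R) = e T (\<lambda>x. indicator (cball 0 R) x + shell_cutoff m R x)"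
      unfolding G_def e_def using that m
      by (intro energy_add[symmetric, OF Lp bump_ball bump_shell_cutoff]) auto
    also have "\<dots> \<le> G T (2 * R)"
      unfolding G_def e_def using that
      by (intro energy_mono[OF Lp sum bump_ball]) (auto simp: indicator_def cutoff_le_1)
    finally show ?thesis .
  qed
  have chain: "\<forall>\<^sub>F T in at_top. real M * (\<delta> * T) \<le> G T (2 ^ M * R0)" for M
  proof (induction M)
    case 0
    show ?case
      by (auto simp: G_def e_def intro!: always_eventually energy_nonneg[OF bump_ball])
  next
    case (Suc M)
    have "2 ^ M * R0 \<ge> R0" using R0(1) by simp
    from Suc.IH shell[OF this] eventually_gt_at_top[of 0] show ?case
    proof eventually_elim
      case (elim T)
      then show ?case using step[of T "2 ^ M * R0"] R0(1) by (simp add: algebra_simps)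
    qed
  qed
  \<comment> \<open>The energy of the last ball is below that of the cutoff at its radius, hence below \<open>H T\<close>.\<close>
  obtain M :: nat where M: "H / \<delta> < real M" using reals_Archimedean2 by blast
  define R where "R = 2 ^ M * R0"
  have R: "R \<ge> R0" "R > 0" using R0(1) by (simp_all add: R_def)
  have "\<forall>\<^sub>F T in at_top. real M * (\<delta> * T) \<le> G T R \<and> e T (cutoff m R) \<le> H * T \<and> T > 0"
    unfolding R_def using chain[of M] upper[OF R(1)] eventually_gt_at_top[of 0]
    by (auto simp: R_def eventually_conj_iff)
  then obtain T where T: "real M * (\<delta> * T) \<le> G T R" "e T (cutoff m R) \<le> H * T" "T > 0"
    using eventually_happens'[OF trivial_limit_at_top_linorder] by blast
  have "G T R \<le> e T (cutoff m R)"
    unfolding G_def e_def using R m T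
    by (intro energy_mono[OF Lp bump_ball bump_cutoff]) (auto simp: indicator_def cutoff_nonneg cutoff_eq_1)
  moreover have "(real M * \<delta>) * T = real M * (\<delta> * T)" by (rule mult.assoc)
  ultimately have "(real M * \<delta>) * T \<le> H * T" using T by linarith
  then have "real M * \<delta> \<le> H" using T(3) by (rule mult_right_le_imp_le)
  then show False using M \<delta> by (simp add: field_simps)
qed

theorem theorem2p1:
  fixes k p \<gamma> :: real and u0 \<omega> :: "real^'n::finite \<Rightarrow> real"
  assumes "k \<ge> 0" and "p > 1" and "0 \<le> \<gamma>" and "\<gamma> < 1"
    and "integrable lebesgue u0" and "integrable lebesgue \<omega>"
    and "(LINT x|lebesgue. \<omega> x) > 0"
  shows "(\<gamma> > 0 \<longrightarrow> \<not> (\<exists>u. global_weak_solution k p \<gamma> u0 \<omega> u)) \<and>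
         (\<gamma> = 0 \<and> CARD('n) \<ge> 3 \<and> p = real CARD('n) / (real CARD('n) - 2) \<longrightarrow>
            \<not> (\<exists>u. global_weak_solution k p \<gamma> u0 \<omega> u))"
  using no_global_weak_solution_fractional[OF assms(1,2) _ assms(4,6,7)] no_global_weak_solution_critical[OF assms(1) _ _ assms(6,7)]
  by blast

end
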